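(* Let $m,n\ge 1$ be integers and let $k_1,\dots,k_n$ be non-negative integers. The generalized chessboard complex $\Delta_{m,n}^{k_1,\dots,k_n;\mathbf{1}}$ is $(\mu-2)$-connected, where $$\mu=\min\{\,m-n+1,\;k_1+\cdots+k_n\,\}.$$ In particular, if $m\ge k_1+\cdots+k_n+n-1$, then $\Delta_{m,n}^{k_1,\dots,k_n;\mathbf{1}}$ is $(k_1+\cdots+k_n-2)$-connected.
   Context: Write $[t]=\{1,\dots,t\}$. The chessboard $[m]\times[n]$ has $n$ rows $[m]\times\{i\}$ ($i\in[n]$), each of length $m$, and $m$ columns $\{j\}\times[n]$ ($j\in[m]$). The complex $\Delta_{m,n}^{k_1,\dots,k_n;\mathbf{1}}$ is the simplicial complex whose simplices are the subsets $A\subset[m]\times[n]$ (rook placements) such that $|A\cap([m]\times\{i\})|\le k_i$ for every $i\in[n]$ (at most $k_i$ rooks in the $i$-th row) and $|A\cap(\{j\}\times[n])|\le 1$ for every $j\in[m]$ (at most one rook in each column). Connectivity is in the homotopical sense and refers to the geometric realization: a space is $c$-connected if it is non-empty and its homotopy groups vanish in all degrees $\le c$; $(-1)$-connected means non-empty, and $c$-connectedness for $c\le -2$ is no condition. *)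

theory Defs
  imports "HOL-Analysis.Analysis"
begin

text \<open>An abstract simplicial complex is represented by its set of simplices (the empty simplex
  included).  A point of the geometric realization is given by its barycentric coordinates.  The
  topology is that of pointwise convergence of the coordinates, which is the usual one (the weak
  topology) for complexes with finitely many vertices; only such complexes occur here.\<close>

definition geometric_realization :: "'v set set \<Rightarrow> ('v \<Rightarrow> real) topology" where
  "geometric_realization K = subtopology (powertop_real UNIV)
     {x. (\<forall>v. 0 \<le> x v) \<and> {v. x v \<noteq> 0} \<in> K \<and> (\<Sum>v | x v \<noteq> 0. x v) = 1}"

definition chessboard_complex :: "nat \<Rightarrow> nat \<Rightarrow> (nat \<Rightarrow> nat) \<Rightarrow> (nat \<times> nat) set set" where
  "chessboard_complex m n k =
     {A. A \<subseteq> {1..m} \<times> {1..n}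
       \<and> (\<forall>i\<in>{1..n}. card (A \<inter> ({1..m} \<times> {i})) \<le> k i)
       \<and> (\<forall>j\<in>{1..m}. card (A \<inter> ({j} \<times> {1..n})) \<le> 1)}"

text \<open>In the library, \<open>nsphere d\<close> is the unit sphere in the coordinates \<open>0, \<dots>, d\<close>; its base point is
  taken to be the first unit vector.\<close>

definition nsphere_base :: "nat \<Rightarrow> real" where
  "nsphere_base = (\<lambda>i. if i = 0 then 1 else 0)"

text \<open>The set underlying \<open>\<pi>\<^sub>d(X, a)\<close>: pointed maps from the \<open>d\<close>-sphere modulo pointed homotopy.
  Its group structure (for positive \<open>d\<close>) is not needed in order to say that it is trivial.\<close>

definition homotopy_classes :: "nat \<Rightarrow> 'a topology \<Rightarrow> 'a \<Rightarrow> ((nat \<Rightarrow> real) \<Rightarrow> 'a) set set" where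
  "homotopy_classes d X a =
     {f. continuous_map (nsphere d) X f \<and> f nsphere_base = a} //
     {(f, g). homotopic_with (\<lambda>h. h nsphere_base = a) (nsphere d) X f g}"

definition connected_up_to :: "int \<Rightarrow> 'a topology \<Rightarrow> bool" where
  "connected_up_to c X \<longleftrightarrow>
     (-1 \<le> c \<longrightarrow> topspace X \<noteq> {}) \<and>
     (\<forall>d. int d \<le> c \<longrightarrow> (\<forall>a\<in>topspace X. is_singleton (homotopy_classes d X a)))"

end

theory Submission
  imports Defs
begin

text \<open>A complex whose simplices can be ordered so that each step either adds a free pair
  \<open>F, F \<union> {v}\<close> or a single simplex of dimension at least \<open>D - 1\<close> is \<open>(D - 2)\<close>-connected: the
  first kind of step is an elementary expansion, and in the second kind a map from a sphere of
  dimension \<open>d \<le> D - 2\<close> can be pushed off the new open simplex by simplicial approximation.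
  Such orders glue: orders for the deletion (with \<open>D\<close>) and for the link (with \<open>D - 1\<close>) of a vertex
  combine to one for the whole complex.  For rook placements the link of a square is again a
  board with one column removed and one row capacity lowered.  Deleting squares until each row has
  a private column, and then all squares outside these columns, leaves a simplex, for which any
  \<open>D\<close> is allowed; the links met on the way lose at most as much in \<open>D\<close> as they are permitted to.\<close>

section \<open>Discrete Morse orders\<close>

text \<open>A discrete Morse condition: the only critical simplices besides a vertex have dimension at
  least \<open>D - 1\<close>.  Since the empty simplex counts as a simplex, the initial vertex arises from the
  rule \<open>pair\<close> with \<open>F = {}\<close> and \<open>K = {}\<close>.\<close>

inductive buildable :: "nat \<Rightarrow> 'v set set \<Rightarrow> bool" for D where
  void: "buildable D {}"
| pair: "\<lbrakk>buildable D K; F \<notin> K; v \<notin> F; finite F; \<And>A. A \<subset> insert v F \<Longrightarrow> A \<noteq> F \<Longrightarrow> A \<in> K\<rbrakk>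
    \<Longrightarrow> buildable D (insert F (insert (insert v F) K))"
| cell: "\<lbrakk>buildable D K; F \<notin> K; finite F; D \<le> card F; \<And>A. A \<subset> F \<Longrightarrow> A \<in> K\<rbrakk>
    \<Longrightarrow> buildable D (insert F K)"

lemma buildable_subset:
  assumes "buildable D K" "A \<in> K" "B \<subseteq> A" shows "B \<in> K"
  using assms
proof (induction arbitrary: A B)
  case (pair K F v)
  show ?case
  proof (cases "A = F \<or> A = insert v F")
    case True
    then show ?thesis
      using pair.prems(2) pair.hyps(5)[of B] by auto
  next
    case False
    then show ?thesis using pair.prems pair.IH by blast
  qed
qed blast+

lemma buildable_finite:
  assumes "buildable D K" shows "finite K" "\<And>A. A \<in> K \<Longrightarrow> finite A"
proof -
  have "finite K \<and> (\<forall>A\<in>K. finite A)"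
    using assms by induction auto
  then show "finite K" "\<And>A. A \<in> K \<Longrightarrow> finite A" by auto
qed

text \<open>For positive \<open>D\<close> the rule \<open>cell\<close> cannot add the empty simplex,
  so the empty simplex enters through \<open>pair\<close>, together with a vertex.\<close>

lemma buildable_vertex:
  assumes "buildable D K" "D \<ge> 1" "K \<noteq> {}" shows "\<exists>v. {v} \<in> K"
  using assms
proof induction
  case (pair K F v)
  show ?case
  proof (cases "F = {}")
    case True then show ?thesis by auto
  next
    case False
    then have "{} \<in> K" using pair.hyps(5)[of "{}"] by auto
    then show ?thesis using pair.IH pair.prems by blast
  qed
next
  case (cell K F)
  have "F \<noteq> {}" using cell by auto
  then have "{} \<in> K" using cell.hyps(5)[of "{}"] by auto
  then show ?case using cell.IH cell.prems by blast
qed auto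

text \<open>With \<open>D = 0\<close> the rule \<open>cell\<close> admits every simplex, so maximal
  simplices can be split off one after another. This is the base case once the demand on
  \<open>D\<close> is used up.\<close>

lemma buildable_0:
  assumes "finite K" "\<And>A. A \<in> K \<Longrightarrow> finite A" "\<And>A B. A \<in> K \<Longrightarrow> B \<subseteq> A \<Longrightarrow> B \<in> K"
  shows "buildable 0 K"
  using assms
proof (induction K rule: finite_psubset_induct)
  case (psubset K)
  show ?case
  proof (cases "K = {}")
    case True then show ?thesis by (simp add: void)
  next
    case False
    obtain F where F: "F \<in> K" "\<And>A. A \<in> K \<Longrightarrow> F \<subseteq> A \<Longrightarrow> A = F"
      using finite_has_maximal[OF psubset.hyps(1) False] by metis
    have "buildable 0 (K - {F})"
    proof (rule psubset.IH)
      show "K - {F} \<subset> K" using F(1) by blast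
      show "\<And>A. A \<in> K - {F} \<Longrightarrow> finite A" using psubset.prems by blast
      show "\<And>A B. A \<in> K - {F} \<Longrightarrow> B \<subseteq> A \<Longrightarrow> B \<in> K - {F}" using psubset.prems(2) F(2) by blast
    qed
    then have "buildable 0 (insert F (K - {F}))"
      by (rule cell) (use F psubset.prems in auto)
    then show ?thesis using F(1) by (simp add: insert_absorb)
  qed
qed

text \<open>Here \<open>K\<close> is the deletion and \<open>L\<close> the link of \<open>v\<close>.
  The order of \<open>L\<close> is replayed on top of \<open>K\<close> with \<open>v\<close> joined
  to each simplex: a free pair stays a free pair, and a single simplex gains a vertex, which is why
  \<open>D - 1\<close> is enough for \<open>L\<close>.\<close>

lemma buildable_cone:
  assumes "buildable (D - 1) L" "buildable D K" "L \<subseteq> K" "\<And>A. A \<in> K \<Longrightarrow> v \<notin> A"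
  shows "buildable D (K \<union> insert v ` L)"
  using assms(1,3)
proof induction
  case void
  then show ?case using assms(2) by simp
next
  case (pair L F w)
  have F: "F \<in> K" "insert w F \<in> K" "L \<subseteq> K" "v \<notin> F" "v \<noteq> w"
    using pair.prems assms(4) by blast+
  \<comment> \<open>Joining with \<open>v\<close> is injective on simplices avoiding
    \<open>v\<close>, so \<open>insert v F\<close> has not been added before.\<close>
  have inj: "A \<in> L" if A: "insert v A \<in> insert v ` L" "v \<notin> A" for A
  proof -
    obtain A' where A': "A' \<in> L" "insert v A = insert v A'" using A(1) by blast
    then have "v \<notin> A'" using F(3) assms(4) by blast
    then have "A = A'" using A'(2) A(2) insert_ident by metis
    then show ?thesis using A'(1) by simp
  qed
  have "buildable D (insert (insert v F) (insert (insert w (insert v F)) (K \<union> insert v ` L)))"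
  proof (rule buildable.pair)
    show "buildable D (K \<union> insert v ` L)" using pair.IH F(3) by simp
    show "insert v F \<notin> K \<union> insert v ` L" using inj[of F] F(4) assms(4)[of "insert v F"] pair.hyps(2) by auto
    show "w \<notin> insert v F" using F pair.hyps(3) by auto
    show "finite (insert v F)" using pair.hyps(4) by auto
    fix A assume A: "A \<subset> insert w (insert v F)" "A \<noteq> insert v F"
    show "A \<in> K \<union> insert v ` L"
    proof (cases "v \<in> A")
      case True
      have "A - {v} \<subset> insert w F" "A - {v} \<noteq> F" using A True F by auto
      then have "A - {v} \<in> L" using pair.hyps(5) by blast
      then show ?thesis using True by (metis UnI2 imageI insert_Diff)
    next
      case False
      then have "A \<subseteq> insert w F" using A by auto
      then show ?thesis using buildable_subset[OF assms(2) F(2)] by blast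
    qed
  qed
  then show ?case by (simp add: insert_commute)
next
  case (cell L F)
  have F: "F \<in> K" "L \<subseteq> K" "v \<notin> F" using cell.prems assms(4) by blast+
  have inj: "A \<in> L" if A: "insert v A \<in> insert v ` L" "v \<notin> A" for A
  proof -
    obtain A' where A': "A' \<in> L" "insert v A = insert v A'" using A(1) by blast
    then have "v \<notin> A'" using F(2) assms(4) by blast
    then have "A = A'" using A'(2) A(2) insert_ident by metis
    then show ?thesis using A'(1) by simp
  qed
  have "buildable D (insert (insert v F) (K \<union> insert v ` L))"
  proof (rule buildable.cell)
    show "buildable D (K \<union> insert v ` L)" using cell.IH F(2) by simp
    show "insert v F \<notin> K \<union> insert v ` L" using inj[of F] F(3) assms(4)[of "insert v F"] cell.hyps(2) by auto
    show "finite (insert v F)" using cell.hyps(3) by auto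
    show "D \<le> card (insert v F)" using F(3) cell.hyps(3,4) by simp
    fix A assume A: "A \<subset> insert v F"
    show "A \<in> K \<union> insert v ` L"
    proof (cases "v \<in> A")
      case True
      have "A - {v} \<subset> F" using A True F by auto
      then have "A - {v} \<in> L" using cell.hyps(5) by blast
      then show ?thesis using True by (metis UnI2 imageI insert_Diff)
    next
      case False
      then have "A \<subseteq> F" using A by auto
      then show ?thesis using buildable_subset[OF assms(2) F(1)] by blast
    qed
  qed
  then show ?case by simp
qed

text \<open>A full simplex is an iterated cone over a vertex. Only free pairs occur in its order, so
  there is no constraint on \<open>D\<close>.\<close>

lemma buildable_Pow:
  assumes "finite S" "S \<noteq> {}" shows "buildable D (Pow S)"
  using assms
proof (induction S arbitrary: D rule: finite_ne_induct)
  case (singleton v)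
  have "buildable D (insert {} (insert (insert v {}) {}))"
    by (rule pair) (auto intro: void)
  then show ?case by (simp add: Pow_insert insert_commute)
next
  case (insert v S)
  have "buildable D (Pow S \<union> insert v ` Pow S)"
    by (rule buildable_cone) (use insert in auto)
  then show ?case by (simp add: Pow_insert)
qed

section \<open>Rook placements on boards\<close>

text \<open>Squares are pairs of column and row. The board is an arbitrary set of squares because
  the inductions delete single squares and thus leave the class of rectangles.\<close>

definition rook_complex :: "('c \<times> 'r) set \<Rightarrow> ('r \<Rightarrow> nat) \<Rightarrow> ('c \<times> 'r) set set" where
  "rook_complex B k = {A. A \<subseteq> B \<and> (\<forall>i. card {c. (c, i) \<in> A} \<le> k i) \<and>
     (\<forall>c i j. (c, i) \<in> A \<longrightarrow> (c, j) \<in> A \<longrightarrow> i = j)}"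

lemma rook_complexD:
  assumes "A \<in> rook_complex B k"
  shows "A \<subseteq> B" "card {c. (c, i) \<in> A} \<le> k i"
    "(c, i) \<in> A \<Longrightarrow> (c, j) \<in> A \<Longrightarrow> i = j"
  using assms unfolding rook_complex_def mem_Collect_eq by simp_all

lemma rook_complexI:
  assumes "A \<subseteq> B" "\<And>i. card {c. (c, i) \<in> A} \<le> k i"
    "\<And>c i j. (c, i) \<in> A \<Longrightarrow> (c, j) \<in> A \<Longrightarrow> i = j"
  shows "A \<in> rook_complex B k"
  using assms unfolding rook_complex_def mem_Collect_eq by simp

lemma finite_rook: "finite B \<Longrightarrow> A \<in> rook_complex B k \<Longrightarrow> finite A"
  using rook_complexD(1) finite_subset by metis

lemma finite_row: "finite A \<Longrightarrow> finite {c. (c, i) \<in> A}"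
  by (rule finite_subset[of _ "fst ` A"]) force+

lemma rook_complex_subset:
  assumes "finite B" "A \<in> rook_complex B k" "A' \<subseteq> A" shows "A' \<in> rook_complex B k"
proof (rule rook_complexI)
  show "A' \<subseteq> B" using assms(3) rook_complexD(1)[OF assms(2)] by simp
  show "card {c. (c, i) \<in> A'} \<le> k i" for i
  proof -
    have "card {c. (c, i) \<in> A'} \<le> card {c. (c, i) \<in> A}"
      by (rule card_mono[OF finite_row[OF finite_rook[OF assms(1,2)]]]) (use assms(3) in auto)
    also have "\<dots> \<le> k i" by (rule rook_complexD(2)[OF assms(2)])
    finally show ?thesis .
  qed
  show "i = j" if "(c, i) \<in> A'" "(c, j) \<in> A'" for c i j
    by (rule rook_complexD(3)[OF assms(2)]) (use that assms(3) in auto)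
qed

lemma buildable_0_rook_complex:
  assumes "finite B" shows "buildable 0 (rook_complex B k)"
proof (rule buildable_0)
  have "rook_complex B k \<subseteq> Pow B" using rook_complexD(1) by auto
  then show "finite (rook_complex B k)" using assms finite_subset by auto
  show "\<And>A. A \<in> rook_complex B k \<Longrightarrow> finite A" by (rule finite_rook[OF assms])
  show "\<And>A A'. A \<in> rook_complex B k \<Longrightarrow> A' \<subseteq> A \<Longrightarrow> A' \<in> rook_complex B k"
    by (rule rook_complex_subset[OF assms])
qed

lemma card_row_insert:
  assumes "finite A" "(c, i) \<notin> A"
  shows "card {x. (x, j) \<in> insert (c, i) A} = card {x. (x, j) \<in> A} + (if j = i then 1 else 0)"
proof (cases "j = i")
  case True
  have "{x. (x, j) \<in> insert (c, i) A} = insert c {x. (x, j) \<in> A}" using True by auto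
  then show ?thesis using assms finite_row[OF assms(1)] True by simp
qed auto

text \<open>A rook on \<open>(c, i)\<close> blocks the rest of column \<open>c\<close> and uses up
  one unit of the capacity of row \<open>i\<close>; the other rooks form a simplex of the link of
  that square.\<close>

lemma rook_complex_delete:
  assumes "finite B" "(c, i) \<in> B" "k i > 0"
  shows "rook_complex B k = rook_complex (B - {(c, i)}) k \<union>
    insert (c, i) ` rook_complex {p \<in> B. fst p \<noteq> c} (k(i := k i - 1))" (is "_ = ?D \<union> ?L")
proof (intro equalityI subsetI)
  fix A assume A: "A \<in> rook_complex B k"
  note AD = rook_complexD[OF A]
  show "A \<in> ?D \<union> ?L"
  proof (cases "(c, i) \<in> A")
    case False
    have "A \<in> ?D" by (rule rook_complexI) (use AD False in auto)
    then show ?thesis by simp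
  next
    case True
    define A' where "A' = A - {(c, i)}"
    have ins: "A = insert (c, i) A'" and ni: "(c, i) \<notin> A'" using True by (auto simp: A'_def)
    have fin: "finite A'" using finite_rook[OF assms(1) A] by (simp add: A'_def)
    have "A' \<in> rook_complex {p \<in> B. fst p \<noteq> c} (k(i := k i - 1))"
    proof (rule rook_complexI)
      show "card {x. (x, j) \<in> A'} \<le> (k(i := k i - 1)) j" for j
        using AD(2)[of j] unfolding ins card_row_insert[OF fin ni] by (auto split: if_splits)
      show "A' \<subseteq> {p \<in> B. fst p \<noteq> c}"
      proof
        fix p assume p: "p \<in> A'"
        have "snd p = i" if "fst p = c" using AD(3)[of c "snd p" i] p True that by (auto simp: A'_def)
        then show "p \<in> {p \<in> B. fst p \<noteq> c}" using p ni AD(1) by (cases p) (auto simp: A'_def)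
      qed
      show "a = b" if "(x, a) \<in> A'" "(x, b) \<in> A'" for x a b
        using AD(3)[of x a b] that by (simp add: A'_def)
    qed
    then show ?thesis using ins by simp
  qed
next
  fix A assume "A \<in> ?D \<union> ?L"
  then show "A \<in> rook_complex B k"
  proof
    assume "A \<in> ?D"
    note AD = rook_complexD[OF this]
    show ?thesis by (rule rook_complexI) (use AD in auto)
  next
    assume "A \<in> ?L"
    then obtain A' where A': "A = insert (c, i) A'"
      "A' \<in> rook_complex {p \<in> B. fst p \<noteq> c} (k(i := k i - 1))" by (rule imageE)
    note AD = rook_complexD[OF A'(2)]
    have fin: "finite A'" and ni: "(c, i) \<notin> A'"
      using AD(1) assms(1) finite_subset[of A' B] by auto
    show ?thesis
    proof (rule rook_complexI)
      show "card {x. (x, j) \<in> A} \<le> k j" for j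
        using AD(2)[of j] assms(3) unfolding A'(1) card_row_insert[OF fin ni] by (auto split: if_splits)
      show "A \<subseteq> B" using A'(1) AD(1) assms(2) by auto
      show "a = b" if "(x, a) \<in> A" "(x, b) \<in> A" for x a b
      proof (cases "x = c")
        case True
        then have "(x, a) \<notin> A'" "(x, b) \<notin> A'" using AD(1) by auto
        then show ?thesis using that A'(1) by auto
      next
        case False
        then show ?thesis using that A'(1) AD(3)[of x a b] by simp
      qed
    qed
  qed
qed

lemma rook_complex_delete_0:
  assumes "finite B" "k i = 0"
  shows "rook_complex B k = rook_complex (B - {(c, i)}) k"
proof (intro equalityI subsetI)
  fix A assume A: "A \<in> rook_complex B k"
  \<comment> \<open>Finiteness of the row matters here, since \<open>card\<close> is also 0 on
    infinite sets.\<close>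
  have "{x. (x, i) \<in> A} = {}"
    using rook_complexD(2)[OF A, of i] finite_row[OF finite_rook[OF assms(1) A], of i] assms(2) by simp
  then have "(c, i) \<notin> A" by auto
  then show "A \<in> rook_complex (B - {(c, i)}) k"
    by (intro rook_complexI) (use rook_complexD[OF A] in auto)
next
  fix A assume A: "A \<in> rook_complex (B - {(c, i)}) k"
  show "A \<in> rook_complex B k" by (rule rook_complexI) (use rook_complexD[OF A] in auto)
qed

lemma buildable_rook_delete:
  assumes "finite B" "(c, i) \<in> B" "buildable D (rook_complex (B - {(c, i)}) k)"
    and "k i > 0 \<Longrightarrow> buildable (D - 1) (rook_complex {p \<in> B. fst p \<noteq> c} (k(i := k i - 1)))"
  shows "buildable D (rook_complex B k)"
proof (cases "k i = 0")
  case True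
  then show ?thesis using assms rook_complex_delete_0[of B k i c] by metis
next
  case False
  show ?thesis
  proof (subst rook_complex_delete[OF assms(1,2)])
    show "buildable D (rook_complex (B - {(c, i)}) k \<union>
      insert (c, i) ` rook_complex {p \<in> B. fst p \<noteq> c} (k(i := k i - 1)))"
    proof (rule buildable_cone)
      show "rook_complex {p \<in> B. fst p \<noteq> c} (k(i := k i - 1)) \<subseteq> rook_complex (B - {(c, i)}) k"
      proof
        fix A assume "A \<in> rook_complex {p \<in> B. fst p \<noteq> c} (k(i := k i - 1))"
        note AD = rook_complexD[OF this]
        have "(k(i := k i - 1)) j \<le> k j" for j by simp
        then have "card {x. (x, j) \<in> A} \<le> k j" for j using AD(2) le_trans by metis
        then show "A \<in> rook_complex (B - {(c, i)}) k" by (intro rook_complexI) (use AD(1,3) in auto)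
      qed
      show "(c, i) \<notin> A" if "A \<in> rook_complex (B - {(c, i)}) k" for A
        using rook_complexD(1)[OF that] by auto
    qed (use assms False in auto)
  qed (use False in auto)
qed

text \<open>Passing to the link of a square costs at most one unit of total capacity, which matches
  the drop from \<open>D\<close> to \<open>D - 1\<close>.\<close>

lemma sum_decrease:
  fixes k :: "'r \<Rightarrow> nat"
  assumes "finite R" "D \<le> sum k R" "k i > 0"
  shows "D - 1 \<le> sum (k(i := k i - 1)) R"
proof (cases "i \<in> R")
  case True
  have "sum k R = k i + sum k (R - {i})" using True assms(1) by (simp add: sum.remove)
  moreover have "sum (k(i := k i - 1)) R = (k i - 1) + sum k (R - {i})"
    using True assms(1) by (simp add: sum.remove)
  ultimately show ?thesis using assms by linarith
next
  case False
  then have "sum (k(i := k i - 1)) R = sum k R" by (intro sum.cong) auto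
  then show ?thesis using assms by linarith
qed

text \<open>If every row has a column \<open>p i\<close> meeting the board only in that row, all other squares can be
  deleted one at a time (links are boards of the same kind), and what remains is a simplex.\<close>

lemma buildable_rook_private:
  assumes "finite B" "finite R" "D \<le> sum k R"
    and "\<And>i. i \<in> R \<Longrightarrow> k i > 0 \<Longrightarrow> (p i, i) \<in> B \<and> (\<forall>j. (p i, j) \<in> B \<longrightarrow> j = i)"
  shows "buildable D (rook_complex B k)"
  using assms(1,3,4)
proof (induction B arbitrary: D k rule: finite_psubset_induct)
  case (psubset B)
  show ?case
  proof (cases "\<exists>c i. (c, i) \<in> B \<and> \<not> (i \<in> R \<and> k i > 0 \<and> c = p i)")
    case True
    then obtain c i where ci: "(c, i) \<in> B" "\<not> (i \<in> R \<and> k i > 0 \<and> c = p i)" by blast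
    show ?thesis
    proof (rule buildable_rook_delete[OF psubset.hyps(1) ci(1)])
      show "buildable D (rook_complex (B - {(c, i)}) k)"
        by (rule psubset.IH) (use ci psubset.prems in auto)
      assume ki: "k i > 0"
      show "buildable (D - 1) (rook_complex {q \<in> B. fst q \<noteq> c} (k(i := k i - 1)))"
      proof (rule psubset.IH)
        have "(c, i) \<notin> {q \<in> B. fst q \<noteq> c}" by simp
        then show "{q \<in> B. fst q \<noteq> c} \<subset> B" using ci(1) by blast
        show "D - 1 \<le> sum (k(i := k i - 1)) R"
          by (rule sum_decrease[OF assms(2) psubset.prems(1) ki])
        fix j assume j: "j \<in> R" "0 < (k(i := k i - 1)) j"
        then have kj: "k j > 0" by (auto split: if_splits)
        \<comment> \<open>If \<open>c\<close> were the private column of row \<open>j\<close>, the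
          square \<open>(c, i)\<close> would force \<open>i = j\<close>, against the choice of
          \<open>(c, i)\<close>.\<close>
        have "p j \<noteq> c" using psubset.prems(2)[OF j(1) kj] ci j kj by blast
        then show "(p j, j) \<in> {q \<in> B. fst q \<noteq> c} \<and> (\<forall>l. (p j, l) \<in> {q \<in> B. fst q \<noteq> c} \<longrightarrow> l = j)"
          using psubset.prems(2)[OF j(1) kj] by auto
      qed
    qed
  next
    case False
    have B: "c = p i" "k i > 0" "i \<in> R" if "(c, i) \<in> B" for c i using that False by blast+
    show ?thesis
    \<comment> \<open>Only private squares are left, at most one in each row and column. The empty
      board is separate: its complex consists of the empty simplex, which is buildable only for
      \<open>D = 0\<close>; but then no row of \<open>R\<close> has positive capacity, so
      \<open>D\<close> is indeed 0.\<close>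
    proof (cases "B = {}")
      case True
      then have "\<forall>i\<in>R. k i = 0" using psubset.prems(2) by blast
      then have "D = 0" using psubset.prems(1) by simp
      then show ?thesis using buildable_0_rook_complex psubset.hyps by blast
    next
      case False
      have "card {c. (c, i) \<in> A} \<le> k i" if "A \<subseteq> B" for A i
      proof (cases "{c. (c, i) \<in> A} = {}")
        case False
        then have "{c. (c, i) \<in> A} = {p i}" "k i > 0" using B that by blast+
        then show ?thesis by simp
      qed (simp only: card.empty)
      moreover have "i = j" if "A \<subseteq> B" "(c, i) \<in> A" "(c, j) \<in> A" for A c i j
        using B that psubset.prems(2) by blast
      ultimately have "A \<in> rook_complex B k" if "A \<subseteq> B" for A
        using that by (intro rook_complexI) auto
      then have "rook_complex B k = Pow B" using rook_complexD(1)[of _ B k] by auto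
      then show ?thesis using buildable_Pow[OF psubset.hyps(1) False] by simp
    qed
  qed
qed

text \<open>The squares of column \<open>c\<close> outside row \<open>r\<close> are deleted one by
  one. The link of \<open>(c, i)\<close> lives on the board without column \<open>c\<close>, so it
  is the same however many squares of that column are already gone.\<close>

lemma buildable_rook_restrict_column:
  assumes "finite B"
    and "buildable D (rook_complex {q \<in> B. fst q = c \<longrightarrow> snd q = r} k)"
    and "\<And>i. (c, i) \<in> B \<Longrightarrow> k i > 0 \<Longrightarrow>
      buildable (D - 1) (rook_complex {q \<in> B. fst q \<noteq> c} (k(i := k i - 1)))"
  shows "buildable D (rook_complex B k)"
  using assms
proof (induction B rule: finite_psubset_induct)
  case (psubset B)
  show ?case
  proof (cases "\<exists>i. (c, i) \<in> B \<and> i \<noteq> r")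
    case True
    then obtain i where i: "(c, i) \<in> B" "i \<noteq> r" by blast
    have eq: "{q \<in> B - {(c, i)}. fst q \<noteq> c} = {q \<in> B. fst q \<noteq> c}"
      "{q \<in> B - {(c, i)}. fst q = c \<longrightarrow> snd q = r} = {q \<in> B. fst q = c \<longrightarrow> snd q = r}"
      using i by auto
    show ?thesis
    proof (rule buildable_rook_delete[OF psubset.hyps(1) i(1)])
      show "buildable D (rook_complex (B - {(c, i)}) k)"
      proof (rule psubset.IH)
        show "B - {(c, i)} \<subset> B" using i(1) by blast
        show "buildable D (rook_complex {q \<in> B - {(c, i)}. fst q = c \<longrightarrow> snd q = r} k)"
          unfolding eq by (rule psubset.prems(1))
        show "buildable (D - 1) (rook_complex {q \<in> B - {(c, i)}. fst q \<noteq> c} (k(j := k j - 1)))"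
          if "(c, j) \<in> B - {(c, i)}" "k j > 0" for j
          unfolding eq using that psubset.prems(2) by blast
      qed
    qed (use psubset.prems(2) i(1) in blast)
  next
    case False
    then have "{q \<in> B. fst q = c \<longrightarrow> snd q = r} = B" by auto
    then show ?thesis using psubset.prems(1) by simp
  qed
qed

text \<open>Here \<open>Q\<close> is the set of rows that do not yet own a private column \<open>p i\<close>, and \<open>U\<close> is a set of
  full columns.  A full column is turned into a private column of a row in \<open>Q\<close> by deleting its other
  squares; this keeps \<open>card U - card Q\<close>, whereas passing to a link lowers it by one.\<close>

lemma buildable_rook:
  assumes "finite B" "finite R" "finite U" "Q \<subseteq> R" "D \<le> sum k R" "D + card Q \<le> card U + 1"
    and "\<And>i. i \<in> R - Q \<Longrightarrow> (p i, i) \<in> B \<and> (\<forall>j. (p i, j) \<in> B \<longrightarrow> j = i)"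
    and "U \<times> R \<subseteq> B"
  shows "buildable D (rook_complex B k)"
  using assms(3,1,4-)
proof (induction U arbitrary: B Q D k p rule: finite_psubset_induct)
  case (psubset U)
  show ?case
  proof (cases "Q = {} \<or> D = 0")
    case True
    then show ?thesis
      using buildable_rook_private[OF psubset.prems(1) assms(2) psubset.prems(3), of p]
        psubset.prems(5) buildable_0_rook_complex[OF psubset.prems(1)] by auto
  next
    case False
    then obtain r where r: "r \<in> Q" by blast
    have fQ: "finite Q" using psubset.prems(2) assms(2) finite_subset by blast
    then have "card Q > 0" using r card_gt_0_iff by blast
    \<comment> \<open>Since \<open>D\<close> and \<open>card Q\<close> are both at least 1, the
      numerical hypothesis leaves at least one full column.\<close>
    then have "card U > 0" using psubset.prems(4) False by linarith
    then obtain c where c: "c \<in> U" by fastforce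
    have cU: "card U = card (U - {c}) + 1" using c psubset.hyps
      by (metis Suc_eq_plus1 card.remove)
    have cQ: "card Q = card (Q - {r}) + 1" using r fQ by (metis Suc_eq_plus1 card.remove)
    have cr: "(c, r) \<in> B" using c r psubset.prems(2,6) by blast
    \<comment> \<open>The full column \<open>c\<close> meets row \<open>r\<close> in
      \<open>Q\<close>, so it cannot be private to a row outside \<open>Q\<close>.\<close>
    have pc: "p i \<noteq> c" if "i \<in> R - Q" for i
      using psubset.prems(5)[OF that] cr r that by blast
    show ?thesis
    proof (rule buildable_rook_restrict_column[OF psubset.prems(1)])
      \<comment> \<open>Deletion branch: \<open>c\<close> becomes the private column of
        \<open>r\<close>, so \<open>U\<close> and \<open>Q\<close> both lose one element and
        \<open>D\<close> is kept.\<close>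
      show "buildable D (rook_complex {q \<in> B. fst q = c \<longrightarrow> snd q = r} k)"
      proof (rule psubset.IH[of "U - {c}" _ "Q - {r}" _ _ "p(r := c)"])
        show "U - {c} \<subset> U" using c by blast
        show "finite {q \<in> B. fst q = c \<longrightarrow> snd q = r}" using psubset.prems(1) by simp
        show "Q - {r} \<subseteq> R" using psubset.prems(2) by blast
        show "D \<le> sum k R" by (rule psubset.prems(3))
        show "D + card (Q - {r}) \<le> card (U - {c}) + 1" using psubset.prems(4) cU cQ by linarith
        show "(U - {c}) \<times> R \<subseteq> {q \<in> B. fst q = c \<longrightarrow> snd q = r}" using psubset.prems(6) by auto
        fix i assume i: "i \<in> R - (Q - {r})"
        show "((p(r := c)) i, i) \<in> {q \<in> B. fst q = c \<longrightarrow> snd q = r} \<and>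
          (\<forall>j. ((p(r := c)) i, j) \<in> {q \<in> B. fst q = c \<longrightarrow> snd q = r} \<longrightarrow> j = i)"
        proof (cases "i = r")
          case True then show ?thesis using cr by auto
        next
          case False
          then have "i \<in> R - Q" using i by blast
          then show ?thesis using psubset.prems(5) pc False by auto
        qed
      qed
    next
      fix i assume i: "(c, i) \<in> B" "k i > 0"
      \<comment> \<open>Link branch: \<open>U\<close> loses \<open>c\<close> while \<open>Q\<close>
        stays, and this is paid for by the drop of \<open>D\<close>, which is a true drop because
        \<open>D\<close> is positive here.\<close>
      show "buildable (D - 1) (rook_complex {q \<in> B. fst q \<noteq> c} (k(i := k i - 1)))"
      proof (rule psubset.IH[of "U - {c}" _ Q _ _ p])
        show "D - 1 \<le> sum (k(i := k i - 1)) R"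
          by (rule sum_decrease[OF assms(2) psubset.prems(3) i(2)])
        show "U - {c} \<subset> U" using c by blast
        show "finite {q \<in> B. fst q \<noteq> c}" using psubset.prems(1) by simp
        show "Q \<subseteq> R" by (rule psubset.prems(2))
        show "D - 1 + card Q \<le> card (U - {c}) + 1" using psubset.prems(4) cU False by linarith
        show "(U - {c}) \<times> R \<subseteq> {q \<in> B. fst q \<noteq> c}" using psubset.prems(6) by auto
        show "(p j, j) \<in> {q \<in> B. fst q \<noteq> c} \<and> (\<forall>l. (p j, l) \<in> {q \<in> B. fst q \<noteq> c} \<longrightarrow> l = j)"
          if "j \<in> R - Q" for j
          using psubset.prems(5)[OF that] pc[OF that] by auto
      qed
    qed
  qed
qed

section \<open>Maps into geometric realizations\<close>

text \<open>As a plain set in a function type, whose own topology is the product topology, this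
  allows continuity to be handled by \<open>continuous_on\<close>.\<close>

definition realization :: "'v set set \<Rightarrow> ('v \<Rightarrow> real) set" where
  "realization K = {x. (\<forall>v. 0 \<le> x v) \<and> {v. x v \<noteq> 0} \<in> K \<and> (\<Sum>v | x v \<noteq> 0. x v) = 1}"

lemma realizationI:
  assumes "\<And>v. 0 \<le> x v" "{v. x v \<noteq> 0} \<in> K" "finite T" "{v. x v \<noteq> 0} \<subseteq> T" "sum x T = 1"
  shows "x \<in> realization K"
proof -
  have "(\<Sum>v | x v \<noteq> 0. x v) = sum x T"
    by (rule sum.mono_neutral_left) (use assms in auto)
  then show ?thesis using assms by (simp add: realization_def)
qed

lemma sum_realization:
  assumes "x \<in> realization K" "finite T" "{v. x v \<noteq> 0} \<subseteq> T" shows "sum x T = 1"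
proof -
  have "(\<Sum>v | x v \<noteq> 0. x v) = sum x T"
    by (rule sum.mono_neutral_left) (use assms in auto)
  then show ?thesis using assms by (simp add: realization_def)
qed

lemma realization_mono: "K \<subseteq> L \<Longrightarrow> realization K \<subseteq> realization L"
  unfolding realization_def by blast

text \<open>The straight-line homotopy in barycentric coordinates stays in the closed simplex that
  carries both \<open>f x\<close> and \<open>g x\<close>.\<close>

lemma homotopic_realization:
  fixes f g :: "'a::topological_space \<Rightarrow> 'v \<Rightarrow> real"
  assumes f: "continuous_on S f" "f \<in> S \<rightarrow> realization K"
    and g: "continuous_on S g" "g \<in> S \<rightarrow> realization K"
    and K: "\<And>A B. A \<in> K \<Longrightarrow> B \<subseteq> A \<Longrightarrow> B \<in> K" "\<And>A. A \<in> K \<Longrightarrow> finite A"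
    and carrier: "\<And>x. x \<in> S \<Longrightarrow> \<exists>A\<in>K. {v. f x v \<noteq> 0} \<subseteq> A \<and> {v. g x v \<noteq> 0} \<subseteq> A"
  shows "homotopic_with_canon (\<lambda>_. True) S (realization K) f g"
proof -
  define h where "h = (\<lambda>p v. (1 - fst p) * f (snd p) v + fst p * g (snd p) v)"
  have "continuous_on ({0..1} \<times> S) h"
  proof (rule continuous_on_coordinatewise_then_product)
    fix v
    have "continuous_on ({0..1::real} \<times> S) (\<lambda>p. f (snd p) v)"
      by (rule continuous_on_compose2[OF continuous_on_product_then_coordinatewise[OF f(1)]])
         (auto intro: continuous_intros)
    moreover have "continuous_on ({0..1::real} \<times> S) (\<lambda>p. g (snd p) v)"
      by (rule continuous_on_compose2[OF continuous_on_product_then_coordinatewise[OF g(1)]])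
         (auto intro: continuous_intros)
    ultimately show "continuous_on ({0..1} \<times> S) (\<lambda>p. h p v)"
      unfolding h_def by (intro continuous_intros)
  qed
  moreover have "h (t, x) \<in> realization K" if t: "t \<in> {0..1}" and x: "x \<in> S" for t x
  proof -
    obtain A where A: "A \<in> K" "{v. f x v \<noteq> 0} \<subseteq> A" "{v. g x v \<noteq> 0} \<subseteq> A"
      using carrier[OF x] by blast
    have fx: "f x \<in> realization K" and gx: "g x \<in> realization K" using f(2) g(2) x by auto
    have "h (t, x) v = 0" if "v \<notin> A" for v
    proof -
      have "f x v = 0" "g x v = 0" using A that by blast+
      then show ?thesis by (simp add: h_def)
    qed
    then have supp: "{v. h (t, x) v \<noteq> 0} \<subseteq> A" by blast
    show ?thesis
    proof (rule realizationI[OF _ K(1)[OF A(1) supp] K(2)[OF A(1)] supp])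
      show "0 \<le> h (t, x) v" for v
        using fx gx t by (auto simp: h_def realization_def)
      have "sum (h (t, x)) A = (1 - t) * sum (f x) A + t * sum (g x) A"
        by (simp add: h_def sum.distrib sum_distrib_left)
      then show "sum (h (t, x)) A = 1"
        using sum_realization[OF fx K(2)[OF A(1)] A(2)] sum_realization[OF gx K(2)[OF A(1)] A(3)] by simp
    qed
  qed
  ultimately have "continuous_map (prod_topology (top_of_set {0..1}) (top_of_set S)) (top_of_set (realization K)) h"
    by (auto simp: image_subset_iff)
  then show ?thesis
    unfolding homotopic_with_def by (intro exI[of _ h]) (auto simp: h_def)
qed

lemma continuous_on_Max:
  fixes f :: "'i \<Rightarrow> 'a::topological_space \<Rightarrow> real"
  assumes "finite I" "I \<noteq> {}" "\<And>i. i \<in> I \<Longrightarrow> continuous_on S (f i)"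
  shows "continuous_on S (\<lambda>x. Max ((\<lambda>i. f i x) ` I))"
  using assms
proof (induction I rule: finite_ne_induct)
  case (insert i I)
  have "continuous_on S (\<lambda>x. max (f i x) (Max ((\<lambda>i. f i x) ` I)))"
    using insert by (intro continuous_intros) auto
  then show ?case using insert by simp
qed simp

lemma continuous_on_Min:
  fixes f :: "'i \<Rightarrow> 'a::topological_space \<Rightarrow> real"
  assumes "finite I" "I \<noteq> {}" "\<And>i. i \<in> I \<Longrightarrow> continuous_on S (f i)"
  shows "continuous_on S (\<lambda>x. Min ((\<lambda>i. f i x) ` I))"
  using assms
proof (induction I rule: finite_ne_induct)
  case (insert i I)
  have "continuous_on S (\<lambda>x. min (f i x) (Min ((\<lambda>i. f i x) ` I)))"
    using insert by (intro continuous_intros) auto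
  then show ?case using insert by simp
qed simp

section \<open>Simplicial approximation on spheres\<close>

definition usphere :: "nat \<Rightarrow> (nat \<Rightarrow> real) set" where
  "usphere d = {x. (\<Sum>i\<le>d. (x i)\<^sup>2) = 1 \<and> (\<forall>i>d. x i = 0)}"

lemma nsphere_eq_usphere: "nsphere d = top_of_set (usphere d)"
  by (simp add: nsphere usphere_def euclidean_product_topology)

lemma continuous_on_coord [continuous_intros]:
  fixes S :: "('i \<Rightarrow> real) set"
  shows "continuous_on S (\<lambda>x. x i)"
  by (rule continuous_on_subset[OF continuous_on_product_coordinates]) auto

lemma usphere_abs_le: assumes "x \<in> usphere d" shows "\<bar>x i\<bar> \<le> 1"
proof (cases "i \<le> d")
  case True
  have "(x i)\<^sup>2 \<le> (\<Sum>i\<le>d. (x i)\<^sup>2)" by (rule member_le_sum) (use True in auto)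
  then show ?thesis using assms abs_square_le_1 by (auto simp: usphere_def)
qed (use assms in \<open>auto simp: usphere_def\<close>)

text \<open>The sphere is a closed subset of a product of intervals \<open>{-1..1}\<close>, which is
  compact by the theorem of Tychonoff.\<close>

lemma compact_usphere: "compact (usphere d)"
proof -
  have "compactin (product_topology (\<lambda>i::nat. euclidean::real topology) UNIV) (PiE UNIV (\<lambda>i. {-1..1}))"
    by (subst compactin_PiE) auto
  then have c: "compact (PiE (UNIV::nat set) (\<lambda>i. {-1..1::real}))"
    by (simp add: euclidean_product_topology)
  have "closed {x :: nat \<Rightarrow> real. (\<Sum>i\<le>d. (x i)\<^sup>2) = 1}"
    by (intro closed_Collect_eq continuous_intros)
  moreover have "closed {x :: nat \<Rightarrow> real. \<forall>i>d. x i = 0}"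
    by (intro closed_Collect_all closed_Collect_imp open_Collect_const closed_Collect_eq continuous_intros)
  ultimately have "closed (usphere d)"
    unfolding usphere_def Collect_conj_eq by (rule closed_Int)
  moreover have "usphere d \<subseteq> PiE UNIV (\<lambda>i. {-1..1})"
  proof
    fix x assume "x \<in> usphere d"
    then have "x i \<in> {-1..1}" for i using usphere_abs_le[of x d i] by auto
    then show "x \<in> PiE UNIV (\<lambda>i. {-1..1})" by (simp add: PiE_def)
  qed
  ultimately show ?thesis using compact_Int_closed[OF c, of "usphere d"] by (simp add: Int_absorb1)
qed

text \<open>The weight is positive iff \<open>y\<close> lies in the open star of the lattice point \<open>v\<close> in the
  Freudenthal triangulation of the space with coordinates \<open>0, \<dots>, d\<close>.  A point with an integer
  coordinate lies on a proper face of a simplex of this triangulation, so at most \<open>d + 1\<close> of its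
  weights are positive: this is how the boundary of a cube gets covering dimension \<open>d\<close>.\<close>

definition grid_weight :: "nat \<Rightarrow> (nat \<Rightarrow> int) \<Rightarrow> (nat \<Rightarrow> real) \<Rightarrow> real" where
  "grid_weight d v y = (\<Prod>i\<le>d. max 0 (1 - \<bar>y i - v i\<bar>)) *
     (\<Prod>i\<le>d. \<Prod>j\<le>d. max 0 (1 - \<bar>(y i - v i) - (y j - v j)\<bar>))"

lemma grid_weight_nonneg: "0 \<le> grid_weight d v y"
  unfolding grid_weight_def by (intro mult_nonneg_nonneg prod_nonneg) auto

lemma grid_weight_pos:
  "0 < grid_weight d v y \<longleftrightarrow> (\<forall>i\<le>d. \<bar>y i - v i\<bar> < 1) \<and> (\<forall>i\<le>d. \<forall>j\<le>d. \<bar>(y i - v i) - (y j - v j)\<bar> < 1)"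
proof -
  have nz: "max 0 (1 - a) \<noteq> 0 \<longleftrightarrow> a < 1" for a :: real by auto
  have "0 < grid_weight d v y \<longleftrightarrow> grid_weight d v y \<noteq> 0" using grid_weight_nonneg[of d v y] by auto
  also have "\<dots> \<longleftrightarrow> (\<forall>i\<le>d. max 0 (1 - \<bar>y i - v i\<bar>) \<noteq> 0) \<and>
      (\<forall>i\<le>d. \<forall>j\<le>d. max 0 (1 - \<bar>(y i - v i) - (y j - v j)\<bar>) \<noteq> 0)"
    unfolding grid_weight_def by auto
  finally show ?thesis unfolding nz .
qed

text \<open>Fractional parts lie in [0, 1), and so any two differ by less than 1. Hence rounding
  down always yields a lattice point of positive weight.\<close>

lemma grid_weight_floor: "0 < grid_weight d (\<lambda>i. if i \<le> d then \<lfloor>y i\<rfloor> else 0) y"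
proof -
  have fl: "0 \<le> y i - \<lfloor>y i\<rfloor> \<and> y i - \<lfloor>y i\<rfloor> < 1" for i by linarith
  have "\<bar>(y i - \<lfloor>y i\<rfloor>) - (y j - \<lfloor>y j\<rfloor>)\<bar> < 1" for i j using fl[of i] fl[of j] by argo
  moreover have "\<bar>y i - \<lfloor>y i\<rfloor>\<bar> < 1" for i using fl[of i] by argo
  ultimately show ?thesis unfolding grid_weight_pos by simp
qed

text \<open>The vertices of a Freudenthal simplex form a chain inside a unit cube. By integrality
  the coordinates of \<open>v - w\<close> have absolute value at most 1 and differ from each other
  by at most 1, so 1 and -1 cannot both occur.\<close>

lemma grid_weight_chain:
  assumes "0 < grid_weight d v y" "0 < grid_weight d w y"
  shows "(\<forall>i\<le>d. v i \<le> w i \<and> w i \<le> v i + 1) \<or> (\<forall>i\<le>d. w i \<le> v i \<and> v i \<le> w i + 1)"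
proof -
  have d1: "\<bar>v i - w i\<bar> \<le> 1" if "i \<le> d" for i
  proof -
    have "\<bar>y i - v i\<bar> < 1" "\<bar>y i - w i\<bar> < 1" using assms that by (auto simp: grid_weight_pos)
    then have "\<bar>real_of_int (v i - w i)\<bar> < 2" by auto
    then show ?thesis by linarith
  qed
  have d2: "\<bar>(v i - w i) - (v j - w j)\<bar> \<le> 1" if "i \<le> d" "j \<le> d" for i j
  proof -
    have "\<bar>(y i - v i) - (y j - v j)\<bar> < 1" "\<bar>(y i - w i) - (y j - w j)\<bar> < 1"
      using assms that by (auto simp: grid_weight_pos)
    then have "\<bar>real_of_int ((v i - w i) - (v j - w j))\<bar> < 2" by auto
    then show ?thesis by linarith
  qed
  show ?thesis
  proof (cases "\<exists>j\<le>d. v j < w j")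
    case True
    then obtain j where j: "j \<le> d" "v j < w j" by blast
    have "v i \<le> w i \<and> w i \<le> v i + 1" if "i \<le> d" for i
      using d1[OF that] d1[OF j(1)] d2[OF that j(1)] j(2) by arith
    then show ?thesis by blast
  next
    case False
    have "w i \<le> v i \<and> v i \<le> w i + 1" if "i \<le> d" for i
      using False d1[OF that] that by force
    then show ?thesis by blast
  qed
qed

text \<open>The coordinate sum is injective on a chain. All points of \<open>V\<close> share the
  coordinate \<open>i0\<close>, and the other \<open>d\<close> coordinates vary by at most 1 each,
  which leaves \<open>d + 1\<close> values for the sum.\<close>

lemma card_grid_weight_pos:
  assumes "finite V" "\<And>v. v \<in> V \<Longrightarrow> 0 < grid_weight d v y" "\<And>v i. v \<in> V \<Longrightarrow> i > d \<Longrightarrow> v i = 0"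
    and "i0 \<le> d" "y i0 \<in> \<int>"
  shows "card V \<le> d + 1"
proof (cases "V = {}")
  case False
  define s where "s = (\<lambda>v::nat \<Rightarrow> int. \<Sum>i\<le>d. v i)"
  have eq: "v i0 = w i0" if "v \<in> V" "w \<in> V" for v w
  proof -
    obtain z where z: "y i0 = of_int z" using assms(5) by (auto elim: Ints_cases)
    have "\<bar>y i0 - v i0\<bar> < 1" "\<bar>y i0 - w i0\<bar> < 1"
      using assms(2)[OF that(1)] assms(2)[OF that(2)] assms(4) by (auto simp: grid_weight_pos)
    then have "\<bar>real_of_int (z - v i0)\<bar> < 1" "\<bar>real_of_int (z - w i0)\<bar> < 1" unfolding z by auto
    then have "\<bar>z - v i0\<bar> < 1" "\<bar>z - w i0\<bar> < 1" by linarith+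
    then show ?thesis by arith
  qed
  have inj: "v = w" if vw: "v \<in> V" "w \<in> V" "s v = s w" for v w
  proof -
    have *: "\<forall>i\<le>d. a i = b i" if "\<forall>i\<le>d. a i \<le> b i" "s a = s b" for a b
    proof -
      have "(\<Sum>i\<le>d. b i - a i) = 0" using that(2) by (simp add: s_def sum_subtractf)
      then have "\<forall>i\<in>{..d}. b i - a i = 0"
        by (subst (asm) sum_nonneg_eq_0_iff) (use that(1) in auto)
      then show ?thesis by auto
    qed
    have "\<forall>i\<le>d. v i = w i"
      using grid_weight_chain[OF assms(2)[OF vw(1)] assms(2)[OF vw(2)]] *[of v w] *[of w v] vw(3) by metis
    then show ?thesis using assms(3) vw by (metis ext linorder_not_le)
  qed
  have le: "s w \<le> s v + d" if vw: "v \<in> V" "w \<in> V" for v w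
  proof -
    have "w i \<le> v i + 1" if "i \<le> d" for i
      using grid_weight_chain[OF assms(2)[OF vw(1)] assms(2)[OF vw(2)]] that by force
    then have "(\<Sum>i\<in>{..d} - {i0}. w i) \<le> (\<Sum>i\<in>{..d} - {i0}. v i + 1)"
      by (intro sum_mono) auto
    also have "\<dots> = (\<Sum>i\<in>{..d} - {i0}. v i) + d" using assms(4) by (simp add: sum.distrib)
    finally show ?thesis using eq[OF vw] assms(4) by (simp add: s_def sum.remove[of "{..d}" i0])
  qed
  obtain v where v: "v \<in> V" "s v = Min (s ` V)"
    using Min_in[of "s ` V"] assms(1) False by fastforce
  have "s w \<in> {s v..s v + d}" if "w \<in> V" for w
    using le[OF v(1) that] that v(2) assms(1) by auto
  then have "s ` V \<subseteq> {s v..s v + d}" by auto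
  then have "card (s ` V) \<le> card {s v..s v + d}" by (intro card_mono) auto
  moreover have "card (s ` V) = card V" by (rule card_image) (use inj in \<open>auto intro: inj_onI\<close>)
  ultimately show ?thesis by simp
qed simp

section \<open>Radial projection of the sphere to the boundary of a cube\<close>

definition maxnorm :: "nat \<Rightarrow> (nat \<Rightarrow> real) \<Rightarrow> real" where
  "maxnorm d x = Max ((\<lambda>i. \<bar>x i\<bar>) ` {..d})"

text \<open>On the boundary of the cube some coordinate is 1 or -1, so scaling by a natural number
  produces an integer coordinate, as \<open>card_grid_weight_pos\<close> requires.\<close>

definition to_cube :: "nat \<Rightarrow> (nat \<Rightarrow> real) \<Rightarrow> nat \<Rightarrow> real" where
  "to_cube d x = (\<lambda>i. x i / maxnorm d x)"

lemma maxnorm_ge: "i \<le> d \<Longrightarrow> \<bar>x i\<bar> \<le> maxnorm d x"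
  unfolding maxnorm_def by (intro Max_ge) auto

lemma maxnorm_attained: obtains i where "i \<le> d" "maxnorm d x = \<bar>x i\<bar>"
proof -
  have "maxnorm d x \<in> (\<lambda>i. \<bar>x i\<bar>) ` {..d}" unfolding maxnorm_def by (rule Max_in) auto
  then show thesis using that by auto
qed

lemma maxnorm_pos: assumes "x \<in> usphere d" shows "0 < maxnorm d x"
proof -
  have "\<exists>i\<le>d. x i \<noteq> 0"
  proof (rule ccontr)
    assume "\<not> ?thesis"
    then have "(\<Sum>i\<le>d. (x i)\<^sup>2) = 0" by simp
    then show False using assms by (simp add: usphere_def)
  qed
  then show ?thesis using maxnorm_ge[of _ d x] by (metis less_le_trans zero_less_abs_iff)
qed

lemma continuous_on_to_cube: "continuous_on (usphere d) (to_cube d)"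
proof (rule continuous_on_coordinatewise_then_product)
  fix i
  have "continuous_on (usphere d) (maxnorm d)"
    unfolding maxnorm_def by (intro continuous_on_Max continuous_intros) auto
  then show "continuous_on (usphere d) (\<lambda>x. to_cube d x i)"
    unfolding to_cube_def by (intro continuous_intros ballI) (use maxnorm_pos in force)+
qed

lemma to_cube_inverse:
  assumes "x \<in> usphere d"
  shows "(\<lambda>i. to_cube d x i / sqrt (\<Sum>j\<le>d. (to_cube d x j)\<^sup>2)) = x"
proof -
  have "(\<Sum>j\<le>d. (to_cube d x j)\<^sup>2) = (\<Sum>j\<le>d. (x j)\<^sup>2) / (maxnorm d x)\<^sup>2"
    by (simp add: to_cube_def power_divide sum_divide_distrib)
  then have "sqrt (\<Sum>j\<le>d. (to_cube d x j)\<^sup>2) = 1 / maxnorm d x"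
    using assms maxnorm_pos[OF assms] by (simp add: usphere_def real_sqrt_divide)
  then show ?thesis using maxnorm_pos[OF assms] by (simp add: to_cube_def)
qed

text \<open>The metric on functions is controlled by twice the largest distance among the first
  coordinates plus a tail \<open>(1/2) ^ n\<close>, and the tail can be made arbitrarily
  small.\<close>

lemma dist_fun_le_coordinates:
  fixes x y :: "nat \<Rightarrow> real"
  assumes "\<And>i. \<bar>x i - y i\<bar> \<le> e"
  shows "dist x y \<le> 2 * e"
proof (rule field_le_epsilon)
  fix r :: real assume "r > 0"
  then obtain n where n: "(1/2::real) ^ n < r" using real_arch_pow_inv[of r "1/2"] by auto
  have "Max {dist (x (from_nat i)) (y (from_nat i)) |i. i \<le> n} \<le> e"
    using assms by (subst Max_le_iff) (auto simp: dist_real_def)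
  then show "dist x y \<le> 2 * e + r" using dist_fun_le_dist_first_terms[of x y n] n by linarith
qed

text \<open>Transported by the projection to the compact boundary of the cube, \<open>f\<close> is
  uniformly continuous there. Closeness is expressed in coordinates scaled by \<open>N\<close>, as
  needed for a lattice of mesh \<open>1 / N\<close>.\<close>

lemma usphere_uniformly_continuous:
  fixes f :: "(nat \<Rightarrow> real) \<Rightarrow> real"
  assumes "continuous_on (usphere d) f" "e > 0"
  shows "\<forall>\<^sub>F N in sequentially. \<forall>x\<in>usphere d. \<forall>y\<in>usphere d.
    (\<forall>i. real N * \<bar>to_cube d x i - to_cube d y i\<bar> \<le> 2) \<longrightarrow> \<bar>f x - f y\<bar> < e"
proof -
  define g where "g = (\<lambda>u::nat \<Rightarrow> real. \<lambda>i. u i / sqrt (\<Sum>j\<le>d. (u j)\<^sup>2))"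
  have inv: "g (to_cube d x) = x" if "x \<in> usphere d" for x
    using to_cube_inverse[OF that] by (simp add: g_def)
  have "continuous_on (to_cube d ` usphere d) g"
    by (rule continuous_on_inv[OF continuous_on_to_cube compact_usphere]) (use inv in blast)
  then have "continuous_on (to_cube d ` usphere d) (\<lambda>u. f (g u))"
    by (rule continuous_on_compose2[OF assms(1)]) (use inv in auto)
  then have "uniformly_continuous_on (to_cube d ` usphere d) (\<lambda>u. f (g u))"
    by (rule compact_uniformly_continuous) (rule compact_continuous_image[OF continuous_on_to_cube compact_usphere])
  then obtain \<delta> where \<delta>: "\<delta> > 0" "\<And>u v. u \<in> to_cube d ` usphere d \<Longrightarrow> v \<in> to_cube d ` usphere d \<Longrightarrow>
      dist u v < \<delta> \<Longrightarrow> dist (f (g u)) (f (g v)) < e"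
    unfolding uniformly_continuous_on_def using assms(2) by metis
  \<comment> \<open>Coordinates within \<open>2 / N\<close> give a distance of at most
    \<open>4 / N\<close>.\<close>
  have "\<forall>\<^sub>F N in sequentially. real N > 4 / \<delta>"
    using filterlim_real_sequentially by (simp add: filterlim_at_top_dense)
  then show ?thesis
  proof eventually_elim
    case (elim N)
    have N: "real N > 0" using elim \<delta>(1) by (meson less_trans divide_pos_pos zero_less_numeral)
    show ?case
    proof (intro ballI impI)
      fix x y assume x: "x \<in> usphere d" and y: "y \<in> usphere d"
        and *: "\<forall>i. real N * \<bar>to_cube d x i - to_cube d y i\<bar> \<le> 2"
      have "\<bar>to_cube d x i - to_cube d y i\<bar> \<le> 2 / N" for i
        using *[rule_format, of i] N by (simp add: field_simps)
      then have "dist (to_cube d x) (to_cube d y) \<le> 2 * (2 / N)" by (rule dist_fun_le_coordinates)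
      also have "\<dots> < \<delta>" using elim N \<delta>(1) by (simp add: field_simps)
      finally have "dist (f (g (to_cube d x))) (f (g (to_cube d y))) < e"
        using \<delta>(2) x y by blast
      then show "\<bar>f x - f y\<bar> < e" using inv x y by (simp add: dist_real_def)
    qed
  qed
qed

text \<open>Simplicial approximation: \<open>g\<close> is the sum of the normalised weights of the lattice points \<open>v\<close>, each
  placed at a vertex \<open>W v\<close> whose open star contains the \<open>f\<close>-image of the star of \<open>v\<close>.\<close>

lemma sphere_map_skeleton:
  fixes f :: "(nat \<Rightarrow> real) \<Rightarrow> 'v \<Rightarrow> real"
  assumes fin: "finite K" "\<And>A. A \<in> K \<Longrightarrow> finite A"
    and down: "\<forall>A\<in>K. \<forall>B\<subseteq>A. B \<in> K"
    and f: "continuous_on (usphere d) f" "f \<in> usphere d \<rightarrow> realization K"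
  obtains g where "continuous_on (usphere d) g" "g \<in> usphere d \<rightarrow> realization K"
    "\<forall>x\<in>usphere d. {w. g x w \<noteq> 0} \<subseteq> {w. f x w \<noteq> 0}"
    "\<forall>x\<in>usphere d. card {w. g x w \<noteq> 0} \<le> d + 1"
proof -
  \<comment> \<open>With \<open>n\<close> larger than the number of vertices, some barycentric
    coordinate of each point is at least \<open>1 / n\<close>, as otherwise they would sum to less
    than 1.\<close>
  define n where "n = real (card (\<Union>K)) + 1"
  have n: "n > 0" by (simp add: n_def)
  have finU: "finite (\<Union>K)" using fin by blast
  have fK: "f x \<in> realization K" if "x \<in> usphere d" for x using f(2) that by blast
  have nonneg: "f x w \<ge> 0" if "x \<in> usphere d" for x w using fK[OF that] by (simp add: realization_def)
  have suppK: "{w. f x w \<noteq> 0} \<in> K" if "x \<in> usphere d" for x using fK[OF that] by (simp add: realization_def)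
  have big: "\<exists>w\<in>\<Union>K. f x w \<ge> 1 / n" if x: "x \<in> usphere d" for x
  proof (rule ccontr)
    assume "\<not> ?thesis"
    then have "sum (f x) (\<Union>K) \<le> real (card (\<Union>K)) * (1 / n)"
      by (intro sum_bounded_above) force
    also have "\<dots> < 1" using n by (simp add: n_def field_simps)
    finally have "sum (f x) (\<Union>K) < 1" .
    moreover have "{w. f x w \<noteq> 0} \<subseteq> \<Union>K" using suppK[OF x] by (rule Union_upper)
    ultimately show False using sum_realization[OF fK[OF x] finU] by simp
  qed
  have "\<forall>\<^sub>F N in sequentially. \<forall>w\<in>\<Union>K. \<forall>x\<in>usphere d. \<forall>x'\<in>usphere d.
      (\<forall>i. real N * \<bar>to_cube d x i - to_cube d x' i\<bar> \<le> 2) \<longrightarrow> \<bar>f x w - f x' w\<bar> < 1 / n"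
    using n by (intro eventually_ball_finite[OF finU] ballI usphere_uniformly_continuous
        continuous_on_product_then_coordinatewise[OF f(1)]) auto
  then obtain N where N: "\<And>w x x'. w \<in> \<Union>K \<Longrightarrow> x \<in> usphere d \<Longrightarrow> x' \<in> usphere d \<Longrightarrow>
      (\<And>i. real N * \<bar>to_cube d x i - to_cube d x' i\<bar> \<le> 2) \<Longrightarrow> \<bar>f x w - f x' w\<bar> < 1 / n"
    unfolding eventually_sequentially by (metis order_refl)
  define y where "y = (\<lambda>x i. real N * to_cube d x i)"
  define V where "V = {v::nat \<Rightarrow> int. \<forall>i. (i \<in> {..d} \<longrightarrow> v i \<in> {- int N..int N}) \<and> (i \<notin> {..d} \<longrightarrow> v i = 0)}"
  have finV: "finite V" unfolding V_def by (rule finite_set_of_finite_funs) auto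
  \<comment> \<open>Two points in the star of \<open>v\<close> have scaled coordinates at most 2
    apart, so a vertex of coordinate at least \<open>1 / n\<close> at one of them keeps a positive
    coordinate on the whole star. For a star that misses the sphere any \<open>w\<close> will
    do.\<close>
  have star: "\<exists>w. \<forall>x\<in>usphere d. 0 < grid_weight d v (y x) \<longrightarrow> f x w > 0" for v
  proof (cases "\<exists>x\<in>usphere d. 0 < grid_weight d v (y x)")
    case True
    then obtain x where x: "x \<in> usphere d" "0 < grid_weight d v (y x)" by blast
    obtain w where w: "w \<in> \<Union>K" "f x w \<ge> 1 / n" using big[OF x(1)] by blast
    have "f x' w > 0" if x': "x' \<in> usphere d" "0 < grid_weight d v (y x')" for x'
    proof -
      have "real N * \<bar>to_cube d x i - to_cube d x' i\<bar> \<le> 2" for i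
      proof (cases "i \<le> d")
        case True
        then have "\<bar>y x i - v i\<bar> < 1" "\<bar>y x' i - v i\<bar> < 1" using x(2) x'(2) by (auto simp: grid_weight_pos)
        then have "\<bar>y x i - y x' i\<bar> \<le> 2" by linarith
        moreover have "\<bar>y x i - y x' i\<bar> = real N * \<bar>to_cube d x i - to_cube d x' i\<bar>"
          by (simp add: y_def abs_mult flip: right_diff_distrib)
        ultimately show ?thesis by simp
      next
        case False
        then show ?thesis using x(1) x'(1) by (simp add: to_cube_def usphere_def)
      qed
      then have "\<bar>f x w - f x' w\<bar> < 1 / n" by (rule N[OF w(1) x(1) x'(1)])
      then show ?thesis using w(2) by linarith
    qed
    then show ?thesis by blast
  qed blast
  then obtain W where W: "\<And>v x. x \<in> usphere d \<Longrightarrow> 0 < grid_weight d v (y x) \<Longrightarrow> f x (W v) > 0" by metis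
  define tot where "tot = (\<lambda>x. \<Sum>v\<in>V. grid_weight d v (y x))"
  define g where "g = (\<lambda>x w. (\<Sum>v\<in>{v\<in>V. W v = w}. grid_weight d v (y x)) / tot x)"
  have tot: "tot x > 0" if x: "x \<in> usphere d" for x
  proof -
    \<comment> \<open>Rounding down gives a point of \<open>V\<close> with positive weight, so the
      denominator of \<open>g\<close> does not vanish.\<close>
    let ?v = "\<lambda>i. if i \<le> d then \<lfloor>y x i\<rfloor> else 0"
    have "\<lfloor>y x i\<rfloor> \<in> {- int N..int N}" if "i \<le> d" for i
    proof -
      have "\<bar>to_cube d x i\<bar> \<le> 1"
        using maxnorm_ge[OF that, of x] maxnorm_pos[OF x] by (simp add: to_cube_def abs_divide)
      then have "\<bar>y x i\<bar> \<le> N" unfolding y_def by (simp add: abs_mult mult_left_le)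
      then have "- real N \<le> y x i" "y x i \<le> real N" by linarith+
      then show ?thesis by (simp add: le_floor_iff floor_le_iff)
    qed
    then have "?v \<in> V" by (simp add: V_def)
    then show ?thesis unfolding tot_def
      using grid_weight_floor[of d "y x"] by (intro sum_pos2[OF finV]) (auto simp: grid_weight_nonneg)
  qed
  have cw: "continuous_on (usphere d) (\<lambda>x. grid_weight d v (y x))" for v
    unfolding grid_weight_def y_def
    by (intro continuous_intros continuous_on_product_then_coordinatewise[OF continuous_on_to_cube])
  have ct: "continuous_on (usphere d) tot" unfolding tot_def by (intro continuous_intros cw)
  have supp: "{w. g x w \<noteq> 0} = W ` {v\<in>V. 0 < grid_weight d v (y x)}" if "x \<in> usphere d" for x
  proof -
    have eq: "g x w \<noteq> 0 \<longleftrightarrow> (\<exists>v\<in>V. W v = w \<and> 0 < grid_weight d v (y x))" for w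
    proof -
      have "g x w \<noteq> 0 \<longleftrightarrow> (\<Sum>v\<in>{v\<in>V. W v = w}. grid_weight d v (y x)) \<noteq> 0"
        using tot[OF that] by (simp add: g_def)
      also have "\<dots> \<longleftrightarrow> (\<exists>v\<in>{v\<in>V. W v = w}. grid_weight d v (y x) \<noteq> 0)"
        using finV by (subst sum_nonneg_eq_0_iff) (auto simp: grid_weight_nonneg)
      also have "\<dots> \<longleftrightarrow> (\<exists>v\<in>V. W v = w \<and> 0 < grid_weight d v (y x))"
        using grid_weight_nonneg[of d _ "y x"] by (auto simp: less_le)
      finally show ?thesis .
    qed
    show ?thesis unfolding eq by auto
  qed
  have sub: "{w. g x w \<noteq> 0} \<subseteq> {w. f x w \<noteq> 0}" if "x \<in> usphere d" for x
    unfolding supp[OF that] using W[OF that] by force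
  show thesis
  proof (rule that)
    show "continuous_on (usphere d) g"
      unfolding g_def
      by (intro continuous_on_coordinatewise_then_product continuous_intros cw ct ballI)
         (use tot in force)
    show "g \<in> usphere d \<rightarrow> realization K"
    proof
      fix x assume x: "x \<in> usphere d"
      show "g x \<in> realization K"
      proof (rule realizationI)
        show "0 \<le> g x w" for w
          using tot[OF x] by (auto simp: g_def intro!: divide_nonneg_pos sum_nonneg grid_weight_nonneg)
        show "{w. g x w \<noteq> 0} \<in> K" using down suppK[OF x] sub[OF x] by blast
        show "finite (W ` V)" using finV by simp
        show "{w. g x w \<noteq> 0} \<subseteq> W ` V" using supp[OF x] by blast
        have "sum (g x) (W ` V) = (\<Sum>w\<in>W ` V. \<Sum>v\<in>{v\<in>V. W v = w}. grid_weight d v (y x)) / tot x"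
          by (simp add: g_def sum_divide_distrib)
        also have "\<dots> = tot x / tot x"
          unfolding tot_def using sum.image_gen[OF finV, of "\<lambda>v. grid_weight d v (y x)" W] by simp
        finally show "sum (g x) (W ` V) = 1" using tot[OF x] by simp
      qed
    qed
    show "\<forall>x\<in>usphere d. card {w. g x w \<noteq> 0} \<le> d + 1"
    proof
      fix x assume x: "x \<in> usphere d"
      obtain i where i: "i \<le> d" "maxnorm d x = \<bar>x i\<bar>" by (rule maxnorm_attained)
      then have "x i \<noteq> 0" using maxnorm_pos[OF x] by auto
      \<comment> \<open>A coordinate attaining the norm is projected to 1 or -1. Its multiple by
        \<open>N\<close> is an integer, which yields the bound \<open>d + 1\<close> in place of the
        \<open>d + 2\<close> vertices of a full simplex of the lattice.\<close>
      then have "y x i = N \<or> y x i = - N" using i by (auto simp: y_def to_cube_def abs_if)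
      then have int: "y x i \<in> \<int>" by auto
      have "card {w. g x w \<noteq> 0} \<le> card {v\<in>V. 0 < grid_weight d v (y x)}"
        unfolding supp[OF x] using finV by (intro card_image_le) auto
      also have "\<dots> \<le> d + 1"
        by (rule card_grid_weight_pos[where y = "y x" and ?i0.0 = i])
           (use finV i(1) int in \<open>auto simp: V_def\<close>)
      finally show "card {w. g x w \<noteq> 0} \<le> d + 1" .
    qed
  qed (use sub in blast)
qed

section \<open>Null homotopies\<close>

text \<open>The homotopies are free, since simplicial approximation need not respect base points;
  these are restored by \<open>pointed_null_homotopy\<close>.\<close>

definition inessential_maps :: "nat \<Rightarrow> 'a::topological_space set \<Rightarrow> bool" where
  "inessential_maps d X \<longleftrightarrow> (\<forall>f. continuous_on (usphere d) f \<longrightarrow> f \<in> usphere d \<rightarrow> X \<longrightarrow>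
     (\<exists>c. homotopic_with_canon (\<lambda>_. True) (usphere d) X f (\<lambda>_. c)))"

lemma inessential_maps_extend:
  assumes X: "inessential_maps d X" "X \<subseteq> Y"
    and "\<And>f. continuous_on (usphere d) f \<Longrightarrow> f \<in> usphere d \<rightarrow> Y \<Longrightarrow>
      \<exists>g. homotopic_with_canon (\<lambda>_. True) (usphere d) Y f g \<and> g \<in> usphere d \<rightarrow> X"
  shows "inessential_maps d Y"
  unfolding inessential_maps_def
proof (intro allI impI)
  fix f :: "(nat \<Rightarrow> real) \<Rightarrow> 'a" assume "continuous_on (usphere d) f" "f \<in> usphere d \<rightarrow> Y"
  then obtain g where g: "homotopic_with_canon (\<lambda>_. True) (usphere d) Y f g" "g \<in> usphere d \<rightarrow> X"
    using assms(3) by blast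
  have "continuous_on (usphere d) g" using homotopic_with_imp_continuous[OF g(1)] by blast
  then obtain c where "homotopic_with_canon (\<lambda>_. True) (usphere d) X g (\<lambda>_. c)"
    using X(1) g(2) unfolding inessential_maps_def by blast
  then have "homotopic_with_canon (\<lambda>_. True) (usphere d) Y g (\<lambda>_. c)"
    by (rule homotopic_with_subset_right[OF _ X(2)])
  then show "\<exists>c. homotopic_with_canon (\<lambda>_. True) (usphere d) Y f (\<lambda>_. c)"
    using homotopic_with_trans[OF g(1)] by blast
qed

text \<open>The approximation \<open>g\<close> has at most \<open>d + 1\<close> positive coordinates
  at each point, fewer than \<open>F\<close> has vertices, so it misses the open simplex
  \<open>F\<close>. It is homotopic to \<open>f\<close> because the support of \<open>f x\<close>
  carries both points.\<close>

lemma inessential_maps_cell: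
  assumes K: "finite K" "\<And>A. A \<in> K \<Longrightarrow> finite A" "\<And>A B. A \<in> K \<Longrightarrow> B \<subseteq> A \<Longrightarrow> B \<in> K"
    and F: "finite F" "d + 1 < card F" "\<And>A. A \<subset> F \<Longrightarrow> A \<in> K"
    and "inessential_maps d (realization K)"
  shows "inessential_maps d (realization (insert F K))"
proof (rule inessential_maps_extend[OF assms(7)])
  show "realization K \<subseteq> realization (insert F K)" by (rule realization_mono) blast
  fix f :: "(nat \<Rightarrow> real) \<Rightarrow> 'a \<Rightarrow> real"
  assume f: "continuous_on (usphere d) f" "f \<in> usphere d \<rightarrow> realization (insert F K)"
  have fin: "finite (insert F K)" "\<And>A. A \<in> insert F K \<Longrightarrow> finite A" using K F(1) by auto
  have down: "\<And>A B. A \<in> insert F K \<Longrightarrow> B \<subseteq> A \<Longrightarrow> B \<in> insert F K" using K(3) F(3) by blast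
  then have down': "\<forall>A\<in>insert F K. \<forall>B\<subseteq>A. B \<in> insert F K" by blast
  obtain g where g: "continuous_on (usphere d) g" "g \<in> usphere d \<rightarrow> realization (insert F K)"
    "\<forall>x\<in>usphere d. {w. g x w \<noteq> 0} \<subseteq> {w. f x w \<noteq> 0}"
    "\<forall>x\<in>usphere d. card {w. g x w \<noteq> 0} \<le> d + 1"
    by (rule sphere_map_skeleton[OF fin down' f])
  have "homotopic_with_canon (\<lambda>_. True) (usphere d) (realization (insert F K)) f g"
  proof (rule homotopic_realization[OF f g(1,2) down fin(2)])
    fix x assume x: "x \<in> usphere d"
    then have "{v. f x v \<noteq> 0} \<in> insert F K" using f(2) unfolding realization_def by blast
    then show "\<exists>A\<in>insert F K. {v. f x v \<noteq> 0} \<subseteq> A \<and> {v. g x v \<noteq> 0} \<subseteq> A" using bspec[OF g(3) x] by blast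
  qed
  moreover have "g \<in> usphere d \<rightarrow> realization K"
  proof
    fix x assume x: "x \<in> usphere d"
    have "{w. g x w \<noteq> 0} \<noteq> F" using bspec[OF g(4) x] F(2) by auto
    then show "g x \<in> realization K" using g(2) x unfolding realization_def by blast
  qed
  ultimately show "\<exists>g. homotopic_with_canon (\<lambda>_. True) (usphere d) (realization (insert F K)) f g \<and>
      g \<in> usphere d \<rightarrow> realization K" by blast
qed

text \<open>The collapse removes from all coordinates in \<open>F\<close> their minimum \<open>s\<close> and gives the mass to \<open>v\<close>;
  as \<open>s = 0\<close> on the simplices not containing \<open>F\<close>, one formula serves the whole complex.\<close>

lemma inessential_maps_pair:
  assumes K: "\<And>A. A \<in> K \<Longrightarrow> finite A" "\<And>A B. A \<in> K \<Longrightarrow> B \<subseteq> A \<Longrightarrow> B \<in> K"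
    and F: "finite F" "F \<noteq> {}" "F \<notin> K" "v \<notin> F"
    and faces: "\<And>A. A \<subset> insert v F \<Longrightarrow> A \<noteq> F \<Longrightarrow> A \<in> K"
    and "inessential_maps d (realization K)"
  shows "inessential_maps d (realization (insert F (insert (insert v F) K)))" (is "inessential_maps d (realization ?K')")
proof (rule inessential_maps_extend[OF assms(8)])
  show sub: "realization K \<subseteq> realization ?K'" by (rule realization_mono) blast
  fix f :: "(nat \<Rightarrow> real) \<Rightarrow> 'a \<Rightarrow> real"
  assume f: "continuous_on (usphere d) f" "f \<in> usphere d \<rightarrow> realization ?K'"
  define s where "s = (\<lambda>z::'a \<Rightarrow> real. Min ((\<lambda>w. z w) ` F))"
  define r where "r = (\<lambda>z w. if w \<in> F then z w - s z else if w = v then z w + card F * s z else z w)"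
  have s_le: "s z \<le> z w" if "w \<in> F" for z w
    unfolding s_def using F(1) that by (intro Min_le) auto
  have s_att: "\<exists>w\<in>F. s z = z w" for z
  proof -
    have "s z \<in> (\<lambda>w. z w) ` F" unfolding s_def by (rule Min_in) (use F in auto)
    then show ?thesis by blast
  qed
  have s_nonneg: "s z \<ge> 0" if "z \<in> realization ?K'" for z
    using s_att[of z] that by (auto simp: realization_def)
  have fin: "\<And>A. A \<in> ?K' \<Longrightarrow> finite A" using K F(1) by auto
  have down: "B \<in> ?K'" if "A \<in> ?K'" "B \<subseteq> A" for A B
  proof (cases "A \<in> K")
    case False
    then have "B \<subseteq> insert v F" using that by blast
    then show ?thesis using faces[of B] by blast
  qed (use K(2) that in blast)
  \<comment> \<open>A positive minimum means that the support contains \<open>F\<close>, so it is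
    one of the two new simplices.\<close>
  have pos: "{w. z w \<noteq> 0} \<subseteq> insert v F" if z: "z \<in> realization ?K'" "s z > 0" for z
  proof -
    have "z w \<noteq> 0" if "w \<in> F" for w using s_le[OF that, of z] z(2) by linarith
    then have "F \<subseteq> {w. z w \<noteq> 0}" by blast
    then have "{w. z w \<noteq> 0} \<notin> K" using K(2) F(3) by blast
    then show ?thesis using z(1) unfolding realization_def by blast
  qed
  have zero: "r z = z" if "s z = 0" for z using that by (auto simp: r_def)
  have rK: "r z \<in> realization K" if z: "z \<in> realization ?K'" for z
  proof (cases "s z = 0")
    case True
    then obtain w where "w \<in> F" "z w = 0" using s_att[of z] by auto
    then have "{w. z w \<noteq> 0} \<noteq> F" "{w. z w \<noteq> 0} \<noteq> insert v F" by blast+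
    then show ?thesis using z unfolding zero[OF True] realization_def by blast
  next
    case False
    then have s: "s z > 0" using s_nonneg[OF z] by simp
    have supp: "{w. r z w \<noteq> 0} \<subseteq> insert v F" using pos[OF z s] by (auto simp: r_def)
    obtain w where w: "w \<in> F" "s z = z w" using s_att by blast
    then have rw: "r z w = 0" by (simp add: r_def)
    show ?thesis
    proof (rule realizationI[OF _ _ _ supp])
      show "0 \<le> r z u" for u
        using z s_le[of u z] s by (auto simp: r_def realization_def)
      \<comment> \<open>The vertex \<open>w\<close> where the minimum is attained drops out of the
        support, so \<open>r z\<close> lies on a face other than \<open>F\<close> and
        \<open>insert v F\<close>.\<close>
      have "{w. r z w \<noteq> 0} \<subset> insert v F" "{w. r z w \<noteq> 0} \<noteq> F" using supp rw w(1) by blast+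
      then show "{w. r z w \<noteq> 0} \<in> K" by (rule faces)
      show "finite (insert v F)" using F(1) by simp
      have "sum (r z) F = sum z F - card F * s z" by (simp add: r_def sum_subtractf)
      then have "sum (r z) (insert v F) = sum z (insert v F)" using F(1,4) by (simp add: r_def)
      then show "sum (r z) (insert v F) = 1"
        using sum_realization[OF z _ pos[OF z s]] F(1) by simp
    qed
  qed
  have cf: "continuous_on (usphere d) (\<lambda>x. f x w)" for w
    by (rule continuous_on_product_then_coordinatewise[OF f(1)])
  have cs: "continuous_on (usphere d) (\<lambda>x. s (f x))"
    unfolding s_def by (rule continuous_on_Min) (use F cf in auto)
  have cr: "continuous_on (usphere d) (\<lambda>x. r (f x))"
  proof (rule continuous_on_coordinatewise_then_product)
    show "continuous_on (usphere d) (\<lambda>x. r (f x) w)" for w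
      unfolding r_def using cf cs by (cases "w \<in> F"; cases "w = v") (auto intro!: continuous_intros)
  qed
  have "homotopic_with_canon (\<lambda>_. True) (usphere d) (realization ?K') f (\<lambda>x. r (f x))"
  proof (rule homotopic_realization[OF f cr _ down fin])
    show "(\<lambda>x. r (f x)) \<in> usphere d \<rightarrow> realization ?K'" using rK sub f(2) by blast
    fix x assume x: "x \<in> usphere d"
    then have z: "f x \<in> realization ?K'" using f(2) by blast
    show "\<exists>A\<in>?K'. {w. f x w \<noteq> 0} \<subseteq> A \<and> {w. r (f x) w \<noteq> 0} \<subseteq> A"
    proof (cases "s (f x) = 0")
      case True
      then show ?thesis using z unfolding zero[OF True] realization_def by blast
    next
      case False
      then have "s (f x) > 0" using s_nonneg[OF z] by simp
      from pos[OF z this] have "{w. f x w \<noteq> 0} \<subseteq> insert v F \<and> {w. r (f x) w \<noteq> 0} \<subseteq> insert v F"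
        by (auto simp: r_def)
      then show ?thesis by blast
    qed
  qed
  moreover have "(\<lambda>x. r (f x)) \<in> usphere d \<rightarrow> realization K" using rK f(2) by blast
  ultimately show "\<exists>g. homotopic_with_canon (\<lambda>_. True) (usphere d) (realization ?K') f g \<and>
      g \<in> usphere d \<rightarrow> realization K" by blast
qed

lemma nsphere_base_in_usphere: "nsphere_base \<in> usphere d"
  using in_topspace_nsphere[of d] by (simp add: nsphere_eq_usphere nsphere_base_def)

lemma buildable_inessential_maps:
  assumes "buildable D K" "d + 2 \<le> D"
  shows "inessential_maps d (realization K)"
  using assms
proof induction
  case void
  \<comment> \<open>The sphere is non-empty, so it has no map into the empty realization.\<close>
  then show ?case using nsphere_base_in_usphere[of d]
    by (auto simp: inessential_maps_def realization_def)
next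
  case (pair K F v)
  show ?case
  proof (cases "F = {}")
    case True
    \<comment> \<open>A non-void complex contains the empty simplex, so this is the initial step,
      and the new realization is a single point.\<close>
    then have "K = {}" using buildable_subset[OF pair.hyps(1), of _ "{}"] pair.hyps(2) by blast
    define c where "c = (\<lambda>w. if w = v then 1 else 0::real)"
    have c: "x = c" if "x \<in> realization (insert F (insert (insert v F) K))" for x
    proof
      have "{w. x w \<noteq> 0} = {} \<or> {w. x w \<noteq> 0} = {v}" "(\<Sum>w | x w \<noteq> 0. x w) = 1"
        using that True \<open>K = {}\<close> by (auto simp: realization_def)
      then have *: "{w. x w \<noteq> 0} = {v}" "x v = 1" by auto
      show "x w = c w" for w using * by (cases "w = v") (auto simp: c_def)
    qed
    show ?thesis unfolding inessential_maps_def
    proof (intro allI impI exI[of _ c])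
      fix f assume f: "continuous_on (usphere d) f" "f \<in> usphere d \<rightarrow> realization (insert F (insert (insert v F) K))"
      show "homotopic_with_canon (\<lambda>_. True) (usphere d) (realization (insert F (insert (insert v F) K))) f (\<lambda>_. c)"
        by (rule homotopic_with_equal) (use f c in \<open>auto simp: image_subset_iff\<close>)
    qed
  next
    case False
    show ?thesis
      by (rule inessential_maps_pair[OF buildable_finite(2)[OF pair.hyps(1)] buildable_subset[OF pair.hyps(1)]])
         (use pair False in auto)
  qed
next
  case (cell K F)
  show ?case
    by (rule inessential_maps_cell[OF buildable_finite[OF cell.hyps(1)] buildable_subset[OF cell.hyps(1)]])
       (use cell in auto)
qed

section \<open>From free null homotopies to trivial pointed homotopy classes\<close>

lemma geometric_realization_eq: "geometric_realization K = top_of_set (realization K)"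
  by (simp add: geometric_realization_def realization_def euclidean_product_topology)

text \<open>Polar coordinates of the ball: the parameter is 1 minus the norm of \<open>y\<close>,
  and at the origin any direction serves.\<close>

lemma cone_in_usphere_image:
  assumes "(\<Sum>i\<le>d. (y i)\<^sup>2) \<le> 1" "\<forall>i>d. y i = 0"
  shows "y \<in> (\<lambda>p i. (1 - fst p) * snd p i) ` ({0..1} \<times> usphere d)"
proof -
  define \<rho> where "\<rho> = sqrt (\<Sum>i\<le>d. (y i)\<^sup>2)"
  have ss: "(\<Sum>i\<le>d. (y i)\<^sup>2) \<ge> 0" by (intro sum_nonneg) auto
  have \<rho>: "0 \<le> \<rho>" "\<rho> \<le> 1" "\<rho>\<^sup>2 = (\<Sum>i\<le>d. (y i)\<^sup>2)" using assms(1) ss by (auto simp: \<rho>_def)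
  show ?thesis
  proof (cases "\<rho> = 0")
    case True
    then have "(\<Sum>i\<le>d. (y i)\<^sup>2) = 0" using \<rho>(3) by simp
    then have "\<forall>i\<in>{..d}. (y i)\<^sup>2 = 0" by (subst (asm) sum_nonneg_eq_0_iff) auto
    then have "y = (\<lambda>i. 0)" using assms(2) by (metis ext atMost_iff not_le zero_eq_power2)
    then show ?thesis
      using nsphere_base_in_usphere[of d] by (intro image_eqI[of _ _ "(1, nsphere_base)"]) auto
  next
    case False
    have "(\<Sum>i\<le>d. (y i / \<rho>)\<^sup>2) = 1"
      using False by (simp add: power_divide flip: sum_divide_distrib \<rho>(3))
    then have "(\<lambda>i. y i / \<rho>) \<in> usphere d" using assms(2) by (simp add: usphere_def)
    then show ?thesis
      using \<rho>(1,2) False by (intro image_eqI[of _ _ "(1 - \<rho>, \<lambda>i. y i / \<rho>)"]) auto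
  qed
qed

text \<open>A null homotopy factors through the cone over the sphere, that is, the ball, and the ball
  contracts linearly to the base point \<open>b\<close>.\<close>

lemma pointed_null_homotopy:
  fixes f :: "(nat \<Rightarrow> real) \<Rightarrow> 'a::topological_space"
  assumes "homotopic_with_canon (\<lambda>_. True) (usphere d) X f (\<lambda>_. c)" "b \<in> usphere d"
  shows "homotopic_with_canon (\<lambda>h. h b = f b) (usphere d) X f (\<lambda>_. f b)"
proof -
  define P where "P = {0..1::real} \<times> usphere d"
  obtain h where h: "continuous_on P h" "h ` P \<subseteq> X"
    and h0: "\<And>x. h (0, x) = f x" and h1: "\<And>x. h (1, x) = c"
    using assms(1) unfolding homotopic_with_def P_def by auto
  define q :: "real \<times> (nat \<Rightarrow> real) \<Rightarrow> nat \<Rightarrow> real" where "q = (\<lambda>p i. (1 - fst p) * snd p i)"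
  define F where "F = (\<lambda>y. h (inv_into P q y))"
  have cq: "continuous_on P q"
  proof (rule continuous_on_coordinatewise_then_product)
    fix i
    have "continuous_on P (\<lambda>p. snd p i)"
      by (rule continuous_on_compose2[OF continuous_on_coord[of UNIV]]) (auto intro: continuous_intros)
    then show "continuous_on P (\<lambda>p. q p i)" unfolding q_def by (intro continuous_intros)
  qed
  \<comment> \<open>The value of \<open>F\<close> does not depend on the preimage chosen by
    \<open>inv_into\<close>: the norm of \<open>q p\<close> determines the time, and before time 1
    also the point of the sphere; at time 1 the homotopy is constant.\<close>
  have Fq: "F (q p) = h p" if p: "p \<in> P" for p
  proof -
    define p' where "p' = inv_into P q (q p)"
    have p': "p' \<in> P" "q p' = q p" using p by (auto simp: p'_def inv_into_into f_inv_into_f)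
    have sq: "(\<Sum>i\<le>d. (q z i)\<^sup>2) = (1 - fst z)\<^sup>2" if "z \<in> P" for z
      using that by (auto simp: P_def q_def usphere_def power_mult_distrib simp flip: sum_distrib_left)
    have "(1 - fst p')\<^sup>2 = (1 - fst p)\<^sup>2" using sq[OF p] sq[OF p'(1)] p'(2) by simp
    then have t: "fst p' = fst p" using p p'(1) by (auto simp: P_def power2_eq_iff)
    have "h p' = h p"
    proof (cases "fst p = 1")
      case True
      then show ?thesis using h1 t by (metis prod.collapse)
    next
      case False
      have "snd p' i = snd p i" for i using fun_cong[OF p'(2), of i] t False by (simp add: q_def)
      then show ?thesis using t by (metis ext prod.collapse)
    qed
    then show ?thesis by (simp add: F_def p'_def)
  qed
  \<comment> \<open>A continuous surjection from a compact space to a Hausdorff space is a quotient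
    map, so \<open>F\<close> inherits continuity from \<open>h\<close>.\<close>
  have "quotient_map (top_of_set P) (top_of_set (q ` P)) q"
  proof (rule T1_Spaces.continuous_imp_quotient_map)
    show "compact_space (top_of_set P)"
      by (simp add: compact_space_subtopology P_def compact_Times compact_usphere)
    show "Hausdorff_space (top_of_set (q ` P))"
      by (simp add: Hausdorff_space_subtopology Hausdorff_space_euclidean)
  qed (use cq in auto)
  moreover have "continuous_map (top_of_set P) (top_of_set X) (F \<circ> q)"
  proof -
    have "continuous_on P (F \<circ> q)" using h(1) by (rule continuous_on_eq) (simp add: Fq)
    moreover have "(F \<circ> q) ` P \<subseteq> X" using h(2) Fq by auto
    ultimately show ?thesis by (simp add: image_subset_iff)
  qed
  ultimately have "continuous_map (top_of_set (q ` P)) (top_of_set X) F"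
    by (rule continuous_compose_quotient_map)
  then have F: "continuous_on (q ` P) F" "F ` q ` P \<subseteq> X" by (auto simp: image_subset_iff)
  have Ff: "F x = f x" if "x \<in> usphere d" for x
    using Fq[of "(0, x)"] that by (simp add: P_def q_def h0)
  define g where "g = (\<lambda>p i. (1 - fst p) * snd p i + fst p * b i :: real)"
  have g: "g p \<in> q ` P" if pP: "p \<in> P" for p
    unfolding q_def P_def
  proof (rule cone_in_usphere_image)
    obtain t x where p: "p = (t, x)" "t \<in> {0..1}" "x \<in> usphere d" using pP by (auto simp: P_def)
    \<comment> \<open>Convexity of squaring keeps the segment from \<open>x\<close> to
      \<open>b\<close> inside the ball.\<close>
    have "(g p i)\<^sup>2 \<le> (1 - t) * (x i)\<^sup>2 + t * (b i)\<^sup>2" for i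
    proof -
      have "(1 - t) * (x i)\<^sup>2 + t * (b i)\<^sup>2 - (g p i)\<^sup>2 = t * (1 - t) * (x i - b i)\<^sup>2"
        by (simp add: g_def p(1) power2_eq_square algebra_simps)
      moreover have "t * (1 - t) * (x i - b i)\<^sup>2 \<ge> 0" using p(2) by auto
      ultimately show ?thesis by linarith
    qed
    then have "(\<Sum>i\<le>d. (g p i)\<^sup>2) \<le> (\<Sum>i\<le>d. (1 - t) * (x i)\<^sup>2 + t * (b i)\<^sup>2)"
      by (intro sum_mono)
    also have "\<dots> = (1 - t) * (\<Sum>i\<le>d. (x i)\<^sup>2) + t * (\<Sum>i\<le>d. (b i)\<^sup>2)"
      by (simp add: sum.distrib sum_distrib_left)
    also have "\<dots> = 1" using p(3) assms(2) by (simp add: usphere_def)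
    finally show "(\<Sum>i\<le>d. (g p i)\<^sup>2) \<le> 1" .
    show "\<forall>i>d. g p i = 0" using p assms(2) by (simp add: g_def usphere_def)
  qed
  have cg: "continuous_on P g"
  proof (rule continuous_on_coordinatewise_then_product)
    fix i
    have "continuous_on P (\<lambda>p. snd p i)"
      by (rule continuous_on_compose2[OF continuous_on_coord[of UNIV]]) (auto intro: continuous_intros)
    then show "continuous_on P (\<lambda>p. g p i)" unfolding g_def by (intro continuous_intros)
  qed
  have "continuous_on P (\<lambda>p. F (g p))"
    by (rule continuous_on_compose2[OF F(1) cg]) (use g in auto)
  moreover have "(\<lambda>p. F (g p)) ` P \<subseteq> X" using F(2) g by blast
  moreover have "F (g (0, x)) = f x" if "x \<in> usphere d" for x
    using Ff[OF that] by (simp add: g_def)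
  moreover have "F (g (1, x)) = f b" for x using Ff[OF assms(2)] by (simp add: g_def)
  \<comment> \<open>The segment from \<open>b\<close> to itself is constant, so this homotopy is
    pointed.\<close>
  moreover have "F (g (t, b)) = f b" for t
    using Ff[OF assms(2)] by (simp add: g_def flip: distrib_right)
  ultimately show ?thesis
    by (subst homotopic_with) (use assms(2) in \<open>auto simp: P_def image_subset_iff intro!: exI[of _ "\<lambda>p. F (g p)"]\<close>)
qed

lemma is_singleton_homotopy_classes:
  assumes "inessential_maps d X" "a \<in> X"
  shows "is_singleton (homotopy_classes d (top_of_set X) a)"
proof -
  define S where "S = {f. continuous_map (nsphere d) (top_of_set X) f \<and> f nsphere_base = a}"
  define r where "r = {(f, g). homotopic_with (\<lambda>h. h nsphere_base = a) (nsphere d) (top_of_set X) f g}"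
  have const: "(\<lambda>_. a) \<in> S" using assms(2) by (simp add: S_def)
  have "((\<lambda>_. a), f) \<in> r" if "f \<in> S" for f
  proof -
    have "continuous_on (usphere d) f" "f \<in> usphere d \<rightarrow> X"
      using that by (auto simp: S_def nsphere_eq_usphere)
    then obtain c where "homotopic_with_canon (\<lambda>_. True) (usphere d) X f (\<lambda>_. c)"
      using assms(1) unfolding inessential_maps_def by blast
    from pointed_null_homotopy[OF this nsphere_base_in_usphere] that
    have "homotopic_with (\<lambda>h. h nsphere_base = a) (nsphere d) (top_of_set X) f (\<lambda>_. a)"
      by (simp add: S_def nsphere_eq_usphere)
    then show ?thesis unfolding r_def by (simp add: homotopic_with_sym)
  qed
  then have "r `` {f} = r `` {\<lambda>_. a}" if "f \<in> S" for f
    using that unfolding r_def by (auto intro: homotopic_with_trans homotopic_with_symD)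
  then have "S // r = {r `` {\<lambda>_. a}}" using const unfolding quotient_def by blast
  then show ?thesis unfolding homotopy_classes_def S_def r_def is_singleton_def by blast
qed

lemma buildable_connected_up_to:
  assumes "buildable D K" "K \<noteq> {}" "c + 2 \<le> int D"
  shows "connected_up_to c (geometric_realization K)"
  unfolding connected_up_to_def geometric_realization_eq topspace_euclidean_subtopology
proof (intro conjI impI allI ballI)
  assume "-1 \<le> c"
  then obtain v where v: "{v} \<in> K" using buildable_vertex[OF assms(1) _ assms(2)] assms(3) by auto
  have "{w. (if w = v then 1 else 0::real) \<noteq> 0} = {v}" by auto
  then have "(\<lambda>w. if w = v then 1 else 0) \<in> realization K"
    using v by (intro realizationI[where T = "{v}"]) auto
  then show "realization K \<noteq> {}" by blast
next
  fix d a assume "int d \<le> c" "a \<in> realization K"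
  then show "is_singleton (homotopy_classes d (top_of_set (realization K)) a)"
    using buildable_inessential_maps[OF assms(1), of d] assms(3) by (intro is_singleton_homotopy_classes) auto
qed

section \<open>The chessboard complex as a rook complex, and the connectivity bound\<close>

lemma chessboard_complex_eq:
  "chessboard_complex m n k = rook_complex ({1..m} \<times> {1..n}) k"
proof -
  have rows: "(\<forall>i\<in>{1..n}. card (A \<inter> {1..m} \<times> {i}) \<le> k i) \<longleftrightarrow> (\<forall>i. card {c. (c, i) \<in> A} \<le> k i)"
    and cols: "(\<forall>j\<in>{1..m}. card (A \<inter> {j} \<times> {1..n}) \<le> 1) \<longleftrightarrow>
      (\<forall>c i j. (c, i) \<in> A \<longrightarrow> (c, j) \<in> A \<longrightarrow> i = j)" if A: "A \<subseteq> {1..m} \<times> {1..n}" for A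
  proof -
    have row: "card (A \<inter> {1..m} \<times> {i}) = card {c. (c, i) \<in> A}" for i
    proof -
      have "A \<inter> {1..m} \<times> {i} = (\<lambda>c. (c, i)) ` {c. (c, i) \<in> A}" using A by auto
      then show ?thesis by (simp add: card_image inj_on_def)
    qed
    \<comment> \<open>Rows off the board hold no rooks, so the bound on them is automatic.\<close>
    have "{c. (c, i) \<in> A} = {}" if "i \<notin> {1..n}" for i using A that by blast
    then show "(\<forall>i\<in>{1..n}. card (A \<inter> {1..m} \<times> {i}) \<le> k i) \<longleftrightarrow> (\<forall>i. card {c. (c, i) \<in> A} \<le> k i)"
      unfolding row by (metis card.empty le0)
    have fin: "finite (A \<inter> {j} \<times> {1..n})" for j by (rule finite_subset[of _ "{j} \<times> {1..n}"]) auto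
    have col: "card (A \<inter> {j} \<times> {1..n}) \<le> 1 \<longleftrightarrow> (\<forall>p\<in>A \<inter> {j} \<times> {1..n}. \<forall>q\<in>A \<inter> {j} \<times> {1..n}. p = q)" for j
      using card_le_Suc0_iff_eq[OF fin[of j]] by simp
    show "(\<forall>j\<in>{1..m}. card (A \<inter> {j} \<times> {1..n}) \<le> 1) \<longleftrightarrow>
      (\<forall>c i j. (c, i) \<in> A \<longrightarrow> (c, j) \<in> A \<longrightarrow> i = j)"
      unfolding col
    proof (intro iffI allI impI ballI)
      fix c i j
      assume *: "\<forall>j\<in>{1..m}. \<forall>p\<in>A \<inter> {j} \<times> {1..n}. \<forall>q\<in>A \<inter> {j} \<times> {1..n}. p = q"
        and ij: "(c, i) \<in> A" "(c, j) \<in> A"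
      then have "c \<in> {1..m}" "(c, i) \<in> A \<inter> {c} \<times> {1..n}" "(c, j) \<in> A \<inter> {c} \<times> {1..n}" using A by auto
      then have "(c, i) = (c, j)" using * by blast
      then show "i = j" by simp
    next
      fix c p q
      assume *: "\<forall>c i j. (c, i) \<in> A \<longrightarrow> (c, j) \<in> A \<longrightarrow> i = j"
        and pq: "p \<in> A \<inter> {c} \<times> {1..n}" "q \<in> A \<inter> {c} \<times> {1..n}"
      from pq obtain i j where "p = (c, i)" "q = (c, j)" by blast
      then show "p = q" using * pq by blast
    qed
  qed
  show ?thesis unfolding chessboard_complex_def rook_complex_def
    by (intro Collect_cong conj_cong refl rows cols)
qed

theorem theorem3p2:
  fixes m n :: nat and k :: "nat \<Rightarrow> nat"
  assumes "m \<ge> 1" and "n \<ge> 1"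
  shows "connected_up_to (min (int m - int n + 1) (\<Sum>i=1..n. int (k i)) - 2)
           (geometric_realization (chessboard_complex m n k))
       \<and> (int m \<ge> (\<Sum>i=1..n. int (k i)) + int n - 1 \<longrightarrow>
           connected_up_to ((\<Sum>i=1..n. int (k i)) - 2)
             (geometric_realization (chessboard_complex m n k)))"
proof -
  define \<mu> where "\<mu> = min (int m - int n + 1) (\<Sum>i=1..n. int (k i))"
  have "buildable (nat \<mu>) (rook_complex ({1..m} \<times> {1..n}) k)"
  proof (cases "\<mu> \<le> 0")
    case True
    then show ?thesis by (simp add: buildable_0_rook_complex)
  next
    case False
    have "nat \<mu> \<le> sum k {1..n}" "nat \<mu> + card {1..n} \<le> card {1..m} + 1"
      using False by (auto simp: \<mu>_def nat_le_iff)
    \<comment> \<open>At the start no row owns a private column and all \<open>m\<close> columns are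
      full; the numerical condition is then the bound of \<open>\<mu>\<close> by
      \<open>m - n + 1\<close>.\<close>
    then show ?thesis
      by (intro buildable_rook[where R = "{1..n}" and Q = "{1..n}" and U = "{1..m}"]) auto
  qed
  moreover have "{} \<in> rook_complex ({1..m} \<times> {1..n}) k" by (simp add: rook_complex_def)
  ultimately have *: "connected_up_to (\<mu> - 2) (geometric_realization (chessboard_complex m n k))"
    unfolding chessboard_complex_eq by (intro buildable_connected_up_to[of "nat \<mu>"]) auto
  moreover have "\<mu> = (\<Sum>i=1..n. int (k i))" if "int m \<ge> (\<Sum>i=1..n. int (k i)) + int n - 1"
    using that by (simp add: \<mu>_def)
  ultimately show ?thesis unfolding \<mu>_def by metis
qed

end
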